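(* Let $1<\gamma\le2$, $X=\{-1,1\}^{\mathbb N}$, $\zeta(\gamma)=\sum_{j\ge1}j^{-\gamma}$ and $\alpha_n=\sum_{j=n+1}^\infty j^{-\gamma}$. Let $\mu=\otimes_{i=1}^\infty\mu_i$ be the product measure with $$\mu_i(\{\pm1\})=\frac{\exp(\pm\sum_{j=1}^i j^{-\gamma})}{2\cosh(\sum_{j=1}^i j^{-\gamma})},$$ let $\tilde\mu=\otimes_{i=1}^\infty\tilde\mu_0$ be the Bernoulli measure with $$\tilde\mu_0(\{\pm1\})=\frac{\exp(\pm\zeta(\gamma))}{2\cosh(\zeta(\gamma))},$$ and let $\rho$ be the $(1/2,1/2)$-Bernoulli product measure on $X$. Let $$h_\rho(x)=\exp\Big(\sum_{i=1}^\infty\alpha_i x_i\Big),\qquad h_\mu(x)=\exp\Big(\sum_{i=1}^\infty\Big(\alpha_i x_i+\log\frac{\cosh(\sum_{j=1}^i j^{-\gamma})}{\cosh(\zeta(\gamma))}\Big)\Big).$$ (1) If $3/2<\gamma\le2$, then $h_\rho(x)=\infty$ for $\mu$-a.e. $x\in X$, and $h_\mu(x)=0$ for $\rho$-a.e. $x\in X$. (2) If $\gamma>3/2$, then $\mu$ and $\tilde\mu$ are absolutely continuous with respect to each other, and $d\tilde\mu=h_\mu\,d\mu$. (3) If $1<\gamma\le3/2$, then $\mu$, $\tilde\mu$ and $\rho$ are pairwise singular. (4) If $3/2<\gamma\le2$, then for any nonempty open set $A\subset X$, $$\operatorname{ess\,inf}_\rho\{h_\rho(x):x\in A\}=\operatorname{ess\,inf}_\mu\{h_\mu(x):x\in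 A\}=0,$$ $$\operatorname{ess\,sup}_\rho\{h_\rho(x):x\in A\}=\operatorname{ess\,sup}_\mu\{h_\mu(x):x\in A\}=\infty.$$ In particular, neither $h_\rho$ nor $h_\mu$ can be extended to a (locally) continuous function.
   Context: $X$ carries the product topology and its Borel $\sigma$-algebra. The infinite series in the definitions of $h_\rho$ and $h_\mu$ are understood as limits of partial sums in $[-\infty,\infty]$, with $\exp(\infty)=\infty$ and $\exp(-\infty)=0$. $\operatorname{ess\,inf}_\nu\{h(x):x\in A\}$ and $\operatorname{ess\,sup}_\nu\{h(x):x\in A\}$ denote the essential infimum and supremum of $h$ restricted to $A$ with respect to the measure $\nu$. For $\gamma>3/2$, the function $h_\rho$ is well defined and finite $\rho$-a.s., and $h_\mu$ is well defined and finite $\mu$-a.s. *)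

theory Defs
  imports "HOL-Probability.Probability"
begin

section \<open>Configuration space and topology\<close>

definition spins :: "real set" where
  "spins = {-1, 1}"

text \<open>Sites are numbered by the positive integers, so a configuration is an extensional
  function on \<open>{1..}\<close>.\<close>

definition conf_top :: "(nat \<Rightarrow> real) topology" where
  "conf_top = product_topology (\<lambda>_. discrete_topology spins) {1..}"

section \<open>The measures\<close>

definition zeta_sum :: "real \<Rightarrow> real" where
  "zeta_sum \<gamma> = (\<Sum>k. real (k + 1) powr (- \<gamma>))"

definition zeta_part :: "real \<Rightarrow> nat \<Rightarrow> real" where
  "zeta_part \<gamma> i = (\<Sum>j=1..i. real j powr (- \<gamma>))"

definition \<alpha> :: "real \<Rightarrow> nat \<Rightarrow> real" where
  "\<alpha> \<gamma> n = (\<Sum>k. real (n + 1 + k) powr (- \<gamma>))"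

definition spin_measure :: "real \<Rightarrow> real measure" where
  "spin_measure b = point_measure spins (\<lambda>s. ennreal (exp (s * b) / (2 * cosh b)))"

definition \<mu> :: "real \<Rightarrow> (nat \<Rightarrow> real) measure" where
  "\<mu> \<gamma> = PiM {1..} (\<lambda>i. spin_measure (zeta_part \<gamma> i))"

definition \<mu>_tilde :: "real \<Rightarrow> (nat \<Rightarrow> real) measure" where
  "\<mu>_tilde \<gamma> = PiM {1..} (\<lambda>_. spin_measure (zeta_sum \<gamma>))"

definition \<rho> :: "(nat \<Rightarrow> real) measure" where
  "\<rho> = PiM {1..} (\<lambda>_. point_measure spins (\<lambda>_. ennreal (1 / 2)))"

section \<open>The functions \<open>h_\<rho>\<close> and \<open>h_\<mu>\<close>\<close>

definition exp_ext :: "ereal \<Rightarrow> ennreal" where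
  "exp_ext s = (case s of ereal r \<Rightarrow> ennreal (exp r) | PInfty \<Rightarrow> \<infinity> | MInfty \<Rightarrow> 0)"

definition S_\<rho> :: "real \<Rightarrow> (nat \<Rightarrow> real) \<Rightarrow> nat \<Rightarrow> ereal" where
  "S_\<rho> \<gamma> x n = ereal (\<Sum>i=1..n. \<alpha> \<gamma> i * x i)"

definition S_\<mu> :: "real \<Rightarrow> (nat \<Rightarrow> real) \<Rightarrow> nat \<Rightarrow> ereal" where
  "S_\<mu> \<gamma> x n =
     ereal (\<Sum>i=1..n. \<alpha> \<gamma> i * x i + ln (cosh (zeta_part \<gamma> i) / cosh (zeta_sum \<gamma>)))"

text \<open>The functions are meaningful only where the partial sums have a limit in
  \<open>[-\<infinity>, \<infinity>]\<close>, that is, where \<open>convergent (S_\<rho> \<gamma> x)\<close> respectively \<open>convergent (S_\<mu> \<gamma> x)\<close>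
  holds; elsewhere \<open>lim\<close> is an unspecified constant.\<close>

definition h_\<rho> :: "real \<Rightarrow> (nat \<Rightarrow> real) \<Rightarrow> ennreal" where
  "h_\<rho> \<gamma> x = exp_ext (lim (S_\<rho> \<gamma> x))"

definition h_\<mu> :: "real \<Rightarrow> (nat \<Rightarrow> real) \<Rightarrow> ennreal" where
  "h_\<mu> \<gamma> x = exp_ext (lim (S_\<mu> \<gamma> x))"

section \<open>General measure-theoretic notions\<close>

definition mutually_singular :: "'a measure \<Rightarrow> 'a measure \<Rightarrow> bool" where
  "mutually_singular M N \<longleftrightarrow> (\<exists>B. B \<in> null_sets M \<and> space N - B \<in> null_sets N)"

text \<open>For measurable \<open>f\<close>, \<open>esssup M f = Inf {z. AE x in M. f x \<le> z}\<close> (fact \<open>esssup_eq_AE\<close>);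
  \<open>essinf\<close> is its order dual.\<close>

definition essinf :: "'a measure \<Rightarrow> ('a \<Rightarrow> ennreal) \<Rightarrow> ennreal" where
  "essinf M f = Sup {z. AE x in M. z \<le> f x}"

section \<open>Adequacy of the encoding\<close>

lemma topspace_conf_top: "topspace conf_top = PiE {1..} (\<lambda>_. spins)"
  by (simp add: conf_top_def)

lemma prob_space_spin_measure: "prob_space (spin_measure b)"
proof
  have "exp (- b) / (2 * cosh b) + exp b / (2 * cosh b) = 1"
    using cosh_real_pos[of b] by (simp add: cosh_def field_simps flip: add_divide_distrib)
  then show "emeasure (spin_measure b) (space (spin_measure b)) = 1"
    by (simp add: spin_measure_def spins_def space_point_measure emeasure_point_measure_finite
        flip: ennreal_plus)
qed

lemma sets_measures:
  "sets (\<mu> \<gamma>) = sets (PiM {1..} (\<lambda>_. count_space spins))"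
  "sets (\<mu>_tilde \<gamma>) = sets (PiM {1..} (\<lambda>_. count_space spins))"
  "sets \<rho> = sets (PiM {1..} (\<lambda>_. count_space spins))"
  unfolding \<mu>_def \<mu>_tilde_def \<rho>_def spin_measure_def
  by (intro sets_PiM_cong refl sets_point_measure_count_space)+

lemma space_measures:
  "space (\<mu> \<gamma>) = topspace conf_top" "space (\<mu>_tilde \<gamma>) = topspace conf_top"
  "space \<rho> = topspace conf_top"
  using sets_measures[THEN sets_eq_imp_space_eq] by (simp_all add: topspace_conf_top space_PiM)

lemma sets_PiM_spins_eq_borel:
  "sets (PiM {1..} (\<lambda>_. count_space spins)) = sigma_sets (topspace conf_top) {U. openin conf_top U}"
  (is "sets ?P = ?B")
proof (rule subset_antisym)
  have cyl: "openin conf_top {f \<in> PiE {1..} (\<lambda>_. spins). f i \<in> A}"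
    if i: "i \<in> {1..}" and A: "A \<subseteq> spins" for i :: nat and A
  proof -
    have "openin conf_top {f \<in> topspace conf_top. f i \<in> A}"
      unfolding conf_top_def
      by (rule openin_continuous_map_preimage[OF continuous_map_product_projection[OF i]])
        (use A in auto)
    then show ?thesis
      by (simp add: topspace_conf_top)
  qed
  have "sigma_sets (PiE {1..} (\<lambda>_. spins))
          {{f \<in> PiE {1..} (\<lambda>_. spins). f i \<in> A} | i A. i \<in> {1::nat..} \<and> A \<in> Pow spins} \<subseteq> ?B"
    proof -
    have "{{f \<in> PiE {1..} (\<lambda>_. spins). f i \<in> A} | i A. i \<in> {1::nat..} \<and> A \<in> Pow spins}
        \<subseteq> {U. openin conf_top U}"
    proof (rule subsetI, elim CollectE exE conjE)
      fix X and i :: nat and A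
      assume "X = {f \<in> PiE {1..} (\<lambda>_. spins). f i \<in> A}" "i \<in> {1..}" "A \<in> Pow spins"
      then show "X \<in> {U. openin conf_top U}"
        using cyl[of i A] by (simp del: atLeast_iff)
    qed
    then show ?thesis
      unfolding topspace_conf_top by (rule sigma_sets_mono')
  qed
  then show "sets ?P \<subseteq> ?B"
    by (simp add: sets_PiM_single)
next
  have sp: "space ?P = topspace conf_top"
    by (simp add: space_PiM topspace_conf_top)
  have "U \<in> sets ?P" if U: "openin conf_top U" for U
  proof -
    define C where "C n p = {y \<in> space ?P. \<forall>i\<in>{1..n}. y i = p i}" for n and p :: "nat \<Rightarrow> real"
    define F where "F n = {p \<in> PiE {1..n} (\<lambda>_. spins). C n p \<subseteq> U}" for n :: nat
    have Cm: "C n p \<in> sets ?P" for n p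
    proof -
      have "{y \<in> space ?P. y i = p i} \<in> sets ?P" if "i \<in> {1..n}" for i
      proof -
        have "i \<in> {1..}" using that by simp
        from measurable_sets[OF measurable_component_singleton[OF this], of "spins \<inter> {p i}"]
        have "(\<lambda>y. y i) -` (spins \<inter> {p i}) \<inter> space ?P \<in> sets ?P"
          by (simp del: atLeast_iff)
        moreover have "(\<lambda>y. y i) -` (spins \<inter> {p i}) \<inter> space ?P = {y \<in> space ?P. y i = p i}"
          using that by (auto simp: space_PiM PiE_def extensional_def Pi_iff)
        ultimately show ?thesis by (simp only:)
      qed
      then show ?thesis
        unfolding C_def by (rule sets.sets_Collect_finite_All) simp_all
    qed
    have "finite (F n)" for n
      by (rule finite_subset[of _ "PiE {1..n} (\<lambda>_. spins)"])
        (auto simp: F_def spins_def intro!: finite_PiE)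
    then have "(\<Union>p\<in>F n. C n p) \<in> sets ?P" for n
      using Cm by (rule sets.finite_UN)
    then have "(\<Union>n. \<Union>p\<in>F n. C n p) \<in> sets ?P"
      by (intro sets.countable_UN) blast
    moreover have "U = (\<Union>n. \<Union>p\<in>F n. C n p)"
    proof
      show "(\<Union>n. \<Union>p\<in>F n. C n p) \<subseteq> U"
        by (auto simp: F_def)
      show "U \<subseteq> (\<Union>n. \<Union>p\<in>F n. C n p)"
      proof
        fix x assume x: "x \<in> U"
        have xs: "x \<in> space ?P"
          using x U openin_subset sp by blast
        obtain V where V: "finite {i \<in> {1..}. V i \<noteq> spins}" "x \<in> PiE {1..} V" "PiE {1..} V \<subseteq> U"
          using U x unfolding conf_top_def openin_product_topology_alt by (auto; blast)
        obtain n where n: "{i \<in> {1..}. V i \<noteq> spins} \<subseteq> {..n}"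
          using V(1) finite_nat_iff_bounded_le by blast
        have "C n x \<subseteq> PiE {1..} V"
        proof
          fix y assume y: "y \<in> C n x"
          show "y \<in> PiE {1..} V"
          proof (rule PiE_I)
            fix i :: nat assume i: "i \<in> {1..}"
            show "y i \<in> V i"
            proof (cases "i \<le> n")
              case True
              then show ?thesis using y i V(2) by (auto simp: C_def PiE_iff)
            next
              case False
              then have "V i = spins" using n i atMost_iff by blast
              then show ?thesis using y i by (auto simp: C_def space_PiM PiE_iff)
            qed
          next
            fix i :: nat assume "i \<notin> {1..}"
            then show "y i = undefined"
              using y by (auto simp: C_def space_PiM PiE_iff extensional_def)
          qed
        qed
        moreover have "C n (restrict x {1..n}) = C n x"
          by (auto simp: C_def)
        ultimately have "restrict x {1..n} \<in> F n" "x \<in> C n (restrict x {1..n})"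
          using V(3) xs by (auto simp: F_def C_def space_PiM PiE_iff)
        then show "x \<in> (\<Union>n. \<Union>p\<in>F n. C n p)"
          by blast
      qed
    qed
    ultimately show ?thesis by simp
  qed
  then show "?B \<subseteq> sets ?P"
    unfolding sp[symmetric] by (intro sets.sigma_sets_subset) auto
qed

lemma borel_measurable_exp_ext[measurable]: "exp_ext \<in> borel_measurable borel"
proof -
  have eq: "exp_ext s =
      (if s = \<infinity> then \<infinity> else if s = -\<infinity> then 0 else ennreal (exp (real_of_ereal s)))" for s
    by (cases s) (simp_all add: exp_ext_def)
  show ?thesis
    unfolding eq[abs_def] by measurable
qed

text \<open>Measurability matters: \<open>esssup\<close> is set to \<open>top\<close> for non-measurable functions.\<close>

lemma borel_measurable_h:
  assumes "sets M = sets (PiM {1..} (\<lambda>_. count_space spins))"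
  shows "h_\<rho> \<gamma> \<in> borel_measurable M" "h_\<mu> \<gamma> \<in> borel_measurable M"
proof -
  have [measurable]: "(\<lambda>x. x i) \<in> borel_measurable M" if "i \<in> {1..}" for i :: nat
    unfolding measurable_cong_sets[OF assms refl]
    by (rule measurable_compose[OF measurable_component_singleton[OF that]]) simp
  show "h_\<rho> \<gamma> \<in> borel_measurable M" "h_\<mu> \<gamma> \<in> borel_measurable M"
    unfolding h_\<rho>_def[abs_def] h_\<mu>_def[abs_def] S_\<rho>_def[abs_def] S_\<mu>_def[abs_def]
    by measurable
qed

end

(*
  All three measures are products of two-point measures with weights proportional to exp(s b_i),
  s = +-1, for some field b (the partial sums of the zeta series, its limit, or 0), and
  alpha_n is of order n^(1-gamma), so that sum alpha_n^2 converges iff gamma > 3/2 and sum alpha_n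
  diverges for gamma <= 2.  Under field b the sums of alpha_i (x_i - tanh b_i) converge almost surely
  by Kolmogorov's theorem when gamma > 3/2, and (1) is read off from the deterministic drift.
  For (2) the finite-volume densities have second moments 1 + sinh^2(alpha_i) / cosh^2(zeta) per
  site, hence are bounded in L^2, and pass to the limit on cylinders.  For (3) Chebyshev's
  inequality separates two fields b and c with sum (c_i - b_i)^2 = infinity, by means of the
  statistic sum (c_i - b_i) (x_i - tanh b_i).  For (4), overwriting finitely many spins preserves null
  sets; setting more and more spins to +1 or -1 inside a cylinder drives h to infinity or 0.
*)

theory Submission
  imports Defs
begin

section \<open>Almost sure convergence of series of independent variables\<close>

text \<open>For 3/2 < \<gamma> \<le> 2 the coefficients \<alpha>_i are square summable but not
  summable, so the exponents converge only conditionally. Each is therefore split into a centred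
  random part, controlled by squares alone, and its mean, where the field enters through E x_i =
  tanh b_i. Since \<alpha>_i is the gap between the limiting and the actual field, the one-site log
  density behind h_\<mu> is \<alpha>_i x_i minus an increment of ln cosh. Under \<mu> the
  first-order terms of its mean cancel and at most \<alpha>_i^2 remains; under \<rho>, and for
  h_\<rho> under \<mu>, nothing cancels and the drift is infinite. Almost sure convergence of
  densities alone would allow mass to escape in the limit; the second moments exclude this.
  Equivalence or singularity according to the summability of squared field differences is Kakutani's
  dichotomy for bounded fields, each half being proved directly.\<close>

primrec stopped_sum :: "real \<Rightarrow> (nat \<Rightarrow> real) \<Rightarrow> nat \<Rightarrow> real" where
  "stopped_sum \<epsilon> x 0 = 0"
| "stopped_sum \<epsilon> x (Suc n) =
     stopped_sum \<epsilon> x n + (if \<bar>stopped_sum \<epsilon> x n\<bar> < \<epsilon> then x n else 0)"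

lemma stopped_sum_cong:
  "(\<And>i. i < n \<Longrightarrow> x i = y i) \<Longrightarrow> stopped_sum \<epsilon> x n = stopped_sum \<epsilon> y n"
  by (induction n) auto

lemma stopped_sum_measurable:
  assumes "{..<n} \<subseteq> I"
  shows "(\<lambda>x. stopped_sum \<epsilon> x n) \<in> borel_measurable (PiM I (\<lambda>_. borel))"
  using assms
proof (induction n)
  case (Suc n)
  then have [measurable]: "(\<lambda>x. stopped_sum \<epsilon> x n) \<in> borel_measurable (PiM I (\<lambda>_. borel))"
    by (simp add: lessThan_Suc)
  have [measurable]: "(\<lambda>x. x n) \<in> borel_measurable (PiM I (\<lambda>_. borel))"
    using Suc.prems by (intro measurable_component_singleton) auto
  show ?case by simp
qed simp

lemma stopped_sum_eq_or_ge:
  "stopped_sum \<epsilon> x n = (\<Sum>i<n. x i) \<or> \<epsilon> \<le> \<bar>stopped_sum \<epsilon> x n\<bar>"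
  by (induction n) auto

lemma stopped_sum_ge:
  assumes "\<epsilon> \<le> \<bar>\<Sum>i<k. x i\<bar>" "k \<le> n"
  shows "\<epsilon> \<le> \<bar>stopped_sum \<epsilon> x n\<bar>"
  using assms(2)
proof (induction n rule: dec_induct)
  case base
  then show ?case using assms(1) stopped_sum_eq_or_ge[of \<epsilon> x k] by auto
qed auto

context prob_space
begin

text \<open>The blocks \<open>{f j}\<close> are disjoint because \<open>f\<close> is injective, so
  grouping of independent families applies, and each block is evaluated at its only index. It serves
  to start a series at a later index and to pass from sites 1, 2, ... to indices 0, 1, ...\<close>

lemma indep_vars_reindex:
  assumes ind: "indep_vars M' X I" and f: "inj_on f J" "f ` J \<subseteq> I"
  shows "indep_vars (\<lambda>j. M' (f j)) (\<lambda>j. X (f j)) J"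
proof -
  have "indep_vars (\<lambda>j. PiM {f j} M') (\<lambda>j \<omega>. \<lambda>i\<in>{f j}. X i \<omega>) J"
    using f by (intro indep_vars_restrict[OF ind]) (auto simp: disjoint_family_on_def inj_on_def)
  then have "indep_vars (\<lambda>j. M' (f j)) (\<lambda>j. (\<lambda>x. x (f j)) \<circ> (\<lambda>\<omega>. \<lambda>i\<in>{f j}. X i \<omega>)) J"
    by (rule indep_vars_compose) auto
  then show ?thesis by (simp add: comp_def)
qed

text \<open>Freezing the partial sums once they leave \<open>(-\<epsilon>, \<epsilon>)\<close> keeps consecutive increments
  uncorrelated, and the frozen sum remembers whether the partial sums ever left the interval;
  so Markov's inequality for its square suffices.\<close>

lemma kolmogorov_maximal_inequality:
  fixes X :: "nat \<Rightarrow> 'a \<Rightarrow> real"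
  assumes ind: "indep_vars (\<lambda>_. borel) X UNIV"
    and sq: "\<And>i. integrable M (\<lambda>\<omega>. (X i \<omega>)\<^sup>2)"
    and mean: "\<And>i. expectation (X i) = 0"
    and eps: "0 < \<epsilon>"
  shows "prob {\<omega>\<in>space M. \<exists>k\<le>n. \<epsilon> \<le> \<bar>\<Sum>i<k. X i \<omega>\<bar>}
           \<le> (\<Sum>i<n. expectation (\<lambda>\<omega>. (X i \<omega>)\<^sup>2)) / \<epsilon>\<^sup>2"
proof -
  have [measurable]: "X i \<in> borel_measurable M" for i
    using ind by (auto simp: indep_vars_def)
  have intX: "integrable M (X i)" for i
    by (rule square_integrable_imp_integrable[OF _ sq]) measurable
  define Z where "Z n \<omega> = stopped_sum \<epsilon> (\<lambda>i. X i \<omega>) n" for n \<omega>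
  have [measurable]: "Z n \<in> borel_measurable M" for n
  proof -
    have "(\<lambda>\<omega>. stopped_sum \<epsilon> (\<lambda>i\<in>UNIV. X i \<omega>) n) \<in> borel_measurable M"
      by (rule measurable_compose[OF _ stopped_sum_measurable]) auto
    then show ?thesis by (simp add: Z_def[abs_def] restrict_def)
  qed
  have Z: "integrable M (\<lambda>\<omega>. (Z n \<omega>)\<^sup>2) \<and>
      expectation (\<lambda>\<omega>. (Z n \<omega>)\<^sup>2) \<le> (\<Sum>i<n. expectation (\<lambda>\<omega>. (X i \<omega>)\<^sup>2))" for n
  proof (induction n)
    case 0
    then show ?case by (simp add: Z_def)
  next
    case (Suc n)
    \<comment> \<open>\<open>g\<close> absorbs the event of not being frozen into the cross term. It
      is bounded by \<epsilon>, hence integrable when composed with \<open>Z n\<close>, and depends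
      on earlier variables only, so the cross term has mean 0.\<close>
    define g :: "real \<Rightarrow> real" where "g z = (if \<bar>z\<bar> < \<epsilon> then z else 0)" for z
    have [measurable]: "g \<in> borel_measurable borel"
      unfolding g_def[abs_def] by measurable
    have "indep_var borel ((\<lambda>x. g (stopped_sum \<epsilon> x n)) \<circ> (\<lambda>\<omega>. \<lambda>i\<in>{..<n}. X i \<omega>))
            borel ((\<lambda>x. x n) \<circ> (\<lambda>\<omega>. \<lambda>i\<in>{n}. X i \<omega>))"
      by (intro indep_var_compose[OF indep_var_restrict[OF ind]]
          measurable_compose[OF stopped_sum_measurable]) auto
    moreover have "stopped_sum \<epsilon> (\<lambda>i\<in>{..<n}. X i \<omega>) n = Z n \<omega>" for \<omega>
      unfolding Z_def by (rule stopped_sum_cong) simp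
    ultimately have indep: "indep_var borel (\<lambda>\<omega>. g (Z n \<omega>)) borel (X n)"
      by (simp add: comp_def)
    have intg: "integrable M (\<lambda>\<omega>. g (Z n \<omega>))"
      by (rule integrable_const_bound[of _ \<epsilon>]) (use eps in \<open>auto simp: g_def\<close>)
    note cross = indep_var_integrable[OF indep intg intX] indep_var_lebesgue_integral[OF indep intg intX]
    define Y where "Y \<omega> = (if \<bar>Z n \<omega>\<bar> < \<epsilon> then (X n \<omega>)\<^sup>2 else 0)" for \<omega>
    have [measurable]: "Y \<in> borel_measurable M"
      unfolding Y_def[abs_def] by measurable
    have intY: "integrable M Y"
      by (rule Bochner_Integration.integrable_bound[OF sq[of n]]) (auto simp: Y_def)
    have EY: "expectation Y \<le> expectation (\<lambda>\<omega>. (X n \<omega>)\<^sup>2)"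
      by (rule integral_mono[OF intY sq]) (auto simp: Y_def)
    have eq: "(Z (Suc n) \<omega>)\<^sup>2 = (Z n \<omega>)\<^sup>2 + 2 * (g (Z n \<omega>) * X n \<omega>) + Y \<omega>" for \<omega>
      by (auto simp: Z_def g_def Y_def power2_sum)
    have "expectation (\<lambda>\<omega>. (Z (Suc n) \<omega>)\<^sup>2) = expectation (\<lambda>\<omega>. (Z n \<omega>)\<^sup>2) + expectation Y"
      unfolding eq using Suc cross intY by (simp add: mean)
    moreover have "integrable M (\<lambda>\<omega>. (Z (Suc n) \<omega>)\<^sup>2)"
      unfolding eq using Suc cross intY by simp
    ultimately show ?case using Suc EY by simp
  qed
  have "prob {\<omega>\<in>space M. \<exists>k\<le>n. \<epsilon> \<le> \<bar>\<Sum>i<k. X i \<omega>\<bar>} \<le> prob {\<omega>\<in>space M. \<epsilon>\<^sup>2 \<le> (Z n \<omega>)\<^sup>2}"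
  proof (rule finite_measure_mono)
    have "\<epsilon>\<^sup>2 \<le> (Z n \<omega>)\<^sup>2" if "\<exists>k\<le>n. \<epsilon> \<le> \<bar>\<Sum>i<k. X i \<omega>\<bar>" for \<omega>
      using that stopped_sum_ge[of \<epsilon> "\<lambda>i. X i \<omega>" _ n] power_mono[of \<epsilon> "\<bar>Z n \<omega>\<bar>" 2] eps
      unfolding Z_def by auto
    then show "{\<omega>\<in>space M. \<exists>k\<le>n. \<epsilon> \<le> \<bar>\<Sum>i<k. X i \<omega>\<bar>} \<subseteq> {\<omega>\<in>space M. \<epsilon>\<^sup>2 \<le> (Z n \<omega>)\<^sup>2}"
      by blast
  qed measurable
  also have "\<dots> \<le> expectation (\<lambda>\<omega>. (Z n \<omega>)\<^sup>2) / \<epsilon>\<^sup>2"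
    using Z[of n] eps by (intro integral_Markov_inequality_measure[where A="{}"]) auto
  also have "\<dots> \<le> (\<Sum>i<n. expectation (\<lambda>\<omega>. (X i \<omega>)\<^sup>2)) / \<epsilon>\<^sup>2"
    using Z[of n] by (intro divide_right_mono) auto
  finally show ?thesis .
qed

text \<open>Uniformly in the length, the maximal inequality bounds the fluctuation of sums starting
  at \<open>m\<close> by the tail of the variances from \<open>m\<close>. This tail tends to 0, so
  almost surely some starting point keeps all further sums below \<epsilon>; taking \<epsilon> =
  1/(j+1) for all \<open>j\<close> gives the Cauchy criterion.\<close>

lemma AE_convergent_sum_indep:
  fixes X :: "nat \<Rightarrow> 'a \<Rightarrow> real"
  assumes ind: "indep_vars (\<lambda>_. borel) X UNIV"
    and sq: "\<And>i. integrable M (\<lambda>\<omega>. (X i \<omega>)\<^sup>2)"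
    and mean: "\<And>i. expectation (X i) = 0"
    and sm: "summable (\<lambda>i. expectation (\<lambda>\<omega>. (X i \<omega>)\<^sup>2))"
  shows "AE \<omega> in M. summable (\<lambda>i. X i \<omega>)"
proof -
  have [measurable]: "X i \<in> borel_measurable M" for i
    using ind by (auto simp: indep_vars_def)
  define v where "v i = expectation (\<lambda>\<omega>. (X i \<omega>)\<^sup>2)" for i
  have v0: "0 \<le> v i" for i by (simp add: v_def)
  have tail: "prob {\<omega>\<in>space M. \<exists>k. \<epsilon> \<le> \<bar>\<Sum>i<k. X (i + m) \<omega>\<bar>} \<le> (\<Sum>i. v (i + m)) / \<epsilon>\<^sup>2"
    if eps: "0 < \<epsilon>" for \<epsilon> m
  proof -
    let ?A = "\<lambda>n. {\<omega>\<in>space M. \<exists>k\<le>n. \<epsilon> \<le> \<bar>\<Sum>i<k. X (i + m) \<omega>\<bar>}"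
    have ind': "indep_vars (\<lambda>_. borel) (\<lambda>i. X (i + m)) UNIV"
      by (rule indep_vars_reindex[OF ind]) auto
    have "prob (?A n) \<le> (\<Sum>i. v (i + m)) / \<epsilon>\<^sup>2" for n
    proof -
      have "prob (?A n) \<le> (\<Sum>i<n. v (i + m)) / \<epsilon>\<^sup>2"
        unfolding v_def by (rule kolmogorov_maximal_inequality[OF ind' sq mean eps])
      also have "\<dots> \<le> (\<Sum>i. v (i + m)) / \<epsilon>\<^sup>2"
        using sm v0 by (intro divide_right_mono sum_le_suminf)
          (auto simp: v_def summable_iff_shift[of "\<lambda>i. expectation (\<lambda>\<omega>. (X i \<omega>)\<^sup>2)"])
      finally show ?thesis .
    qed
    moreover have "(\<lambda>n. prob (?A n)) \<longlonglongrightarrow> prob (\<Union>n. ?A n)"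
      by (rule finite_Lim_measure_incseq) (auto simp: incseq_def intro: order_trans)
    moreover have "(\<Union>n. ?A n) = {\<omega>\<in>space M. \<exists>k. \<epsilon> \<le> \<bar>\<Sum>i<k. X (i + m) \<omega>\<bar>}"
      by auto
    ultimately show ?thesis
      by (metis (no_types, lifting) LIMSEQ_le_const2)
  qed
  have vlim: "(\<lambda>m. (\<Sum>i. v (i + m)) / \<epsilon>\<^sup>2) \<longlonglongrightarrow> 0" for \<epsilon>
    using suminf_exist_split2[of v] sm by (auto simp: v_def[abs_def] intro!: tendsto_divide_zero)
  have "AE \<omega> in M. \<exists>m. \<forall>k. \<bar>\<Sum>i<k. X (i + m) \<omega>\<bar> < \<epsilon>" if eps: "0 < \<epsilon>" for \<epsilon>
  proof -
    let ?B = "{\<omega>\<in>space M. \<forall>m. \<exists>k. \<epsilon> \<le> \<bar>\<Sum>i<k. X (i + m) \<omega>\<bar>}"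
    have "prob ?B \<le> (\<Sum>i. v (i + m)) / \<epsilon>\<^sup>2" for m
    proof -
      have "prob ?B \<le> prob {\<omega>\<in>space M. \<exists>k. \<epsilon> \<le> \<bar>\<Sum>i<k. X (i + m) \<omega>\<bar>}"
        by (rule finite_measure_mono) auto
      then show ?thesis using tail[OF eps, of m] by simp
    qed
    then have "prob ?B \<le> 0"
      by (intro LIMSEQ_le_const[OF vlim[of \<epsilon>]]) auto
    then have "prob ?B = 0"
      using measure_nonneg[of M ?B] by linarith
    then have "AE \<omega> in M. \<omega> \<notin> ?B"
      by (subst (asm) prob_eq_0) measurable
    then show ?thesis
      using AE_space by eventually_elim (auto simp: not_le)
  qed
  then have "AE \<omega> in M. \<forall>j. \<exists>m. \<forall>k. \<bar>\<Sum>i<k. X (i + m) \<omega>\<bar> < inverse (real (Suc j))"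
    by (subst AE_all_countable) auto
  then show ?thesis
  proof eventually_elim
    case (elim \<omega>)
    show ?case
    proof (rule summable_Cauchy[THEN iffD2], intro allI impI)
      fix e :: real assume "0 < e"
      then obtain j where j: "inverse (real (Suc j)) < e / 2"
        using reals_Archimedean[of "e / 2"] by auto
      obtain m where m: "\<And>k. \<bar>\<Sum>i<k. X (i + m) \<omega>\<bar> < inverse (real (Suc j))"
        using elim by blast
      have sub: "(\<Sum>i=m..<n. X i \<omega>) = (\<Sum>i<n-m. X (i + m) \<omega>)" if "m \<le> n" for n
        using sum.shift_bounds_nat_ivl[of "\<lambda>i. X i \<omega>" 0 m "n - m"] that
        by (simp add: atLeast0LessThan)
      \<comment> \<open>A block from \<open>p\<close> to \<open>q\<close> is the difference of two
        blocks starting at \<open>m\<close>, each below e/2.\<close>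
      have "norm (\<Sum>i=p..<q. X i \<omega>) < e" if "m \<le> p" for p q
      proof (cases "p \<le> q")
        case True
        have "(\<Sum>i=m..<q. X i \<omega>) = (\<Sum>i=m..<p. X i \<omega>) + (\<Sum>i=p..<q. X i \<omega>)"
          using that True by (simp add: sum.atLeastLessThan_concat)
        then show ?thesis
          using m[of "p - m"] m[of "q - m"] sub[of p] sub[of q] that True j
          by simp
      next
        case False
        then show ?thesis using \<open>0 < e\<close> by simp
      qed
      then show "\<exists>N. \<forall>m\<ge>N. \<forall>n. norm (sum (\<lambda>i. X i \<omega>) {m..<n}) < e"
        by blast
    qed
  qed
qed

end

section \<open>The tails of the zeta series, and hyperbolic estimates\<close>

lemma summable_powr_shift:
  "1 < \<gamma> \<Longrightarrow> summable (\<lambda>k. real (n + 1 + k) powr (- \<gamma>))"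
  using summable_iff_shift[of "\<lambda>k. real k powr (- \<gamma>)" "n + 1"]
  by (simp add: summable_real_powr_iff add.commute)

text \<open>This makes \<alpha>_n the difference of the fields of \<open>\<mu>_tilde\<close> and
  \<open>\<mu>\<close> at site n, which ties the coefficients of the exponents to likelihood
  ratios.\<close>

lemma \<alpha>_eq:
  assumes "1 < \<gamma>"
  shows "\<alpha> \<gamma> n = zeta_sum \<gamma> - zeta_part \<gamma> n"
proof -
  have "zeta_part \<gamma> n = (\<Sum>k<n. real (k + 1) powr (- \<gamma>))"
    by (simp add: zeta_part_def sum.atLeast1_atMost_eq add.commute)
  then show ?thesis
    using suminf_minus_initial_segment[of "\<lambda>k. real (k + 1) powr (- \<gamma>)" n]
      summable_powr_shift[OF assms, of 0]
    by (simp add: \<alpha>_def zeta_sum_def ac_simps)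
qed

lemma \<alpha>_pos:
  assumes "1 < \<gamma>"
  shows "0 < \<alpha> \<gamma> n"
  unfolding \<alpha>_def by (rule suminf_pos[OF summable_powr_shift[OF assms]]) simp

lemma zeta_part_ge_1: "1 \<le> i \<Longrightarrow> 1 \<le> zeta_part \<gamma> i"
  unfolding zeta_part_def
  using member_le_sum[of 1 "{1..i}" "\<lambda>j. real j powr (- \<gamma>)"] by simp

text \<open>Keep the n terms with n < j \<le> 2n of the tail and bound each below by the last
  one.\<close>

lemma \<alpha>_ge:
  assumes "1 < \<gamma>" "1 \<le> n"
  shows "2 powr (- \<gamma>) * real n powr (1 - \<gamma>) \<le> \<alpha> \<gamma> n"
proof -
  have "2 powr (- \<gamma>) * real n powr (1 - \<gamma>) = (\<Sum>k<n. real (2 * n) powr (- \<gamma>))"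
    using assms by (simp add: powr_mult powr_diff powr_minus field_simps)
  also have "\<dots> \<le> (\<Sum>k<n. real (n + 1 + k) powr (- \<gamma>))"
    using assms by (intro sum_mono powr_mono2') auto
  also have "\<dots> \<le> \<alpha> \<gamma> n"
    unfolding \<alpha>_def by (rule sum_le_suminf[OF summable_powr_shift[OF assms(1)]]) auto
  finally show ?thesis .
qed

text \<open>Integral comparison: \<open>F\<close> samples an antiderivative of t^(-\<gamma>) at n +
  k; by the mean value theorem its increments dominate the terms of the tail, and they telescope to
  - \<open>F 0\<close>.\<close>

lemma \<alpha>_le:
  assumes "1 < \<gamma>" "1 \<le> n"
  shows "\<alpha> \<gamma> n \<le> real n powr (1 - \<gamma>) / (\<gamma> - 1)"
proof -
  define F where "F k = - (real (n + k) powr (1 - \<gamma>) / (\<gamma> - 1))" for k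
  have "filterlim (\<lambda>k. real (k + n)) at_top sequentially"
    by (rule filterlim_compose[OF filterlim_real_sequentially filterlim_add_const_nat_at_top])
  then have "(\<lambda>k. real (n + k) powr (1 - \<gamma>)) \<longlonglongrightarrow> 0"
    using assms by (intro tendsto_neg_powr) (auto simp: add.commute)
  then have "F \<longlonglongrightarrow> 0"
    using tendsto_minus[OF tendsto_divide[OF _ tendsto_const[of "\<gamma> - 1"]]] assms
    unfolding F_def[abs_def] by fastforce
  then have sums: "(\<lambda>k. F (Suc k) - F k) sums (0 - F 0)"
    by (rule telescope_sums)
  have "real (n + 1 + k) powr (- \<gamma>) \<le> F (Suc k) - F k" for k
  proof -
    define G where "G t = - (t powr (1 - \<gamma>) / (\<gamma> - 1))" for t :: real
    have "\<exists>z>real (n + k). z < real (n + k) + 1 \<and>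
        G (real (n + k) + 1) - G (real (n + k)) = (real (n + k) + 1 - real (n + k)) * z powr (- \<gamma>)"
    proof (rule MVT2)
      fix t assume "real (n + k) \<le> t"
      then have "0 < t" using assms by linarith
      have "- ((1 - \<gamma>) * t powr (1 - \<gamma> - 1) / (\<gamma> - 1)) = - ((1 - \<gamma>) / (\<gamma> - 1)) * t powr (- \<gamma>)"
        by simp
      also have "- ((1 - \<gamma>) / (\<gamma> - 1)) = 1"
        using assms by (simp add: minus_divide_left)
      finally have eq: "- ((1 - \<gamma>) * t powr (1 - \<gamma> - 1) / (\<gamma> - 1)) = t powr (- \<gamma>)"
        by simp
      show "(G has_real_derivative t powr (- \<gamma>)) (at t)"
        unfolding G_def[abs_def] eq[symmetric]
        by (intro DERIV_minus DERIV_cdivide has_real_derivative_powr \<open>0 < t\<close>)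
    qed simp
    then obtain z where z: "real (n + k) < z" "z < real (n + k) + 1"
      "G (real (n + k) + 1) - G (real (n + k)) = z powr (- \<gamma>)" by auto
    have "real (n + 1 + k) powr (- \<gamma>) \<le> z powr (- \<gamma>)"
      using z assms by (intro powr_mono2') auto
    then show ?thesis
      using z(3) by (simp add: F_def G_def add.commute add.left_commute)
  qed
  then have "\<alpha> \<gamma> n \<le> (\<Sum>k. F (Suc k) - F k)"
    unfolding \<alpha>_def using sums summable_powr_shift[OF assms(1)]
    by (intro suminf_le) (auto simp: sums_iff)
  also have "\<dots> = real n powr (1 - \<gamma>) / (\<gamma> - 1)"
    using sums by (simp add: sums_iff F_def)
  finally show ?thesis .
qed

text \<open>The lower and the upper power bound serve one direction each: the squares are comparable
  to n^(2 - 2 \<gamma>), and this exponent is below -1 exactly when \<gamma> > 3/2.\<close>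

lemma summable_\<alpha>_sq_iff:
  assumes "1 < \<gamma>"
  shows "summable (\<lambda>i. (\<alpha> \<gamma> (Suc i))\<^sup>2) \<longleftrightarrow> 3 / 2 < \<gamma>"
proof -
  have sq: "(real n powr (1 - \<gamma>))\<^sup>2 = real n powr (2 - 2 * \<gamma>)" if "1 \<le> n" for n
    using that by (simp add: powr_power)
  have iff: "summable (\<lambda>i. real (Suc i) powr (2 - 2 * \<gamma>)) \<longleftrightarrow> 3 / 2 < \<gamma>"
    by (subst summable_Suc_iff[of "\<lambda>i. real i powr (2 - 2 * \<gamma>)"])
      (auto simp: summable_real_powr_iff)
  show ?thesis
  proof
    assume sm: "summable (\<lambda>i. (\<alpha> \<gamma> (Suc i))\<^sup>2)"
    have le: "(2 powr (- \<gamma>))\<^sup>2 * real (Suc i) powr (2 - 2 * \<gamma>) \<le> (\<alpha> \<gamma> (Suc i))\<^sup>2" for i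
      using power_mono[OF \<alpha>_ge[OF assms, of "Suc i"], of 2] sq[of "Suc i"]
      by (simp add: power_mult_distrib)
    from sm have "summable (\<lambda>i. (2 powr (- \<gamma>))\<^sup>2 * real (Suc i) powr (2 - 2 * \<gamma>))"
      by (rule summable_comparison_test'[where N = 0]) (use le in \<open>simp del: of_nat_Suc\<close>)
    then show "3 / 2 < \<gamma>"
      by (subst (asm) summable_cmult_iff) (use iff in \<open>simp del: of_nat_Suc\<close>)
  next
    assume "3 / 2 < \<gamma>"
    then have sm: "summable (\<lambda>i. (1 / (\<gamma> - 1))\<^sup>2 * real (Suc i) powr (2 - 2 * \<gamma>))"
      using iff by (intro summable_mult) simp
    have le: "(\<alpha> \<gamma> (Suc i))\<^sup>2 \<le> (1 / (\<gamma> - 1))\<^sup>2 * real (Suc i) powr (2 - 2 * \<gamma>)" for i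
      using power_mono[OF \<alpha>_le[OF assms, of "Suc i"], of 2] sq[of "Suc i"]
        \<alpha>_pos[OF assms, of "Suc i"]
      by (simp add: power_divide)
    from sm show "summable (\<lambda>i. (\<alpha> \<gamma> (Suc i))\<^sup>2)"
      by (rule summable_comparison_test'[where N = 0]) (use le in \<open>simp del: of_nat_Suc\<close>)
  qed
qed

lemma not_summable_\<alpha>:
  assumes "1 < \<gamma>" "\<gamma> \<le> 2"
  shows "\<not> summable (\<lambda>i. \<alpha> \<gamma> (Suc i))"
proof
  assume "summable (\<lambda>i. \<alpha> \<gamma> (Suc i))"
  then have "summable (\<lambda>i. 2 powr (- \<gamma>) * real (Suc i) powr (1 - \<gamma>))"
    by (rule summable_comparison_test'[where N = 0])
      (use \<alpha>_ge[OF assms(1)] in \<open>simp del: of_nat_Suc\<close>)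
  then have "summable (\<lambda>i. real (Suc i) powr (1 - \<gamma>))"
    by (subst (asm) summable_cmult_iff) simp
  then have "summable (\<lambda>i. real i powr (1 - \<gamma>))"
    by (subst (asm) summable_Suc_iff[of "\<lambda>i. real i powr (1 - \<gamma>)"])
  then show False
    using assms by (simp add: summable_real_powr_iff)
qed

section \<open>Mean value estimates for tanh and ln cosh\<close>

lemma tanh_diff_ge:
  fixes u v Z :: real
  assumes "u \<le> v" "\<bar>u\<bar> \<le> Z" "\<bar>v\<bar> \<le> Z"
  shows "(v - u) / (cosh Z)\<^sup>2 \<le> tanh v - tanh u"
proof (cases "u = v")
  case False
  then have "u < v" using assms by simp
  have "(tanh has_real_derivative 1 - (tanh x)\<^sup>2) (at x)" for x :: real
    by (auto intro!: derivative_eq_intros simp: tanh_def)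
  then have "\<exists>z>u. z < v \<and> tanh v - tanh u = (v - u) * (1 - (tanh z)\<^sup>2)"
    using \<open>u < v\<close> by (intro MVT2) auto
  then obtain z where z: "u < z" "z < v" "tanh v - tanh u = (v - u) * (1 - (tanh z)\<^sup>2)" by auto
  \<comment> \<open>The derivative 1 - tanh^2 = 1/cosh^2 decreases in the absolute value of its
    argument, so on [-Z, Z] it is smallest at the ends.\<close>
  have "cosh z \<le> cosh Z"
    using z assms by (subst cosh_real_abs[symmetric], subst cosh_real_nonneg_le_iff) auto
  then have "(cosh z)\<^sup>2 \<le> (cosh Z)\<^sup>2"
    using cosh_real_pos[of z] by (intro power_mono) auto
  moreover have "1 - (tanh z)\<^sup>2 = ((cosh z)\<^sup>2 - (sinh z)\<^sup>2) / (cosh z)\<^sup>2"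
    by (simp add: tanh_def power_divide diff_divide_distrib)
  then have "1 - (tanh z)\<^sup>2 = 1 / (cosh z)\<^sup>2"
    by (simp add: hyperbolic_pythagoras)
  ultimately show ?thesis
    using z(1,2) cosh_real_pos[of z] unfolding z(3)
    by (simp add: divide_inverse le_imp_inverse_le)
qed simp

lemma tanh_diff_le:
  fixes u v :: real
  assumes "u \<le> v"
  shows "tanh v - tanh u \<le> v - u"
proof (cases "u = v")
  case False
  then have "u < v" using assms by simp
  have "(tanh has_real_derivative 1 - (tanh x)\<^sup>2) (at x)" for x :: real
    by (auto intro!: derivative_eq_intros simp: tanh_def)
  then have "\<exists>z>u. z < v \<and> tanh v - tanh u = (v - u) * (1 - (tanh z)\<^sup>2)"
    using \<open>u < v\<close> by (intro MVT2) auto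
  then obtain z where "u < z" "z < v" "tanh v - tanh u = (v - u) * (1 - (tanh z)\<^sup>2)" by auto
  moreover have "(v - u) * (1 - (tanh z)\<^sup>2) \<le> (v - u) * 1"
    using \<open>u < v\<close> by (intro mult_left_mono) auto
  ultimately show ?thesis by simp
qed simp

text \<open>The derivative tanh of ln cosh is increasing, so the increment lies between its values
  at the two ends times v - u. Replacing tanh v by tanh u costs at most (v - u)^2 because tanh is
  1-Lipschitz; this quadratic remainder is where the squares of the field differences come
  from.\<close>

lemma ln_cosh_diff_bounds:
  fixes u v :: real
  assumes "u \<le> v"
  shows "tanh u * (v - u) \<le> ln (cosh v / cosh u)"
    and "ln (cosh v / cosh u) \<le> tanh u * (v - u) + (v - u)\<^sup>2"
proof -
  have "tanh u * (v - u) \<le> ln (cosh v / cosh u) \<and> ln (cosh v / cosh u) \<le> tanh v * (v - u)"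
  proof (cases "u = v")
    case False
    then have "u < v" using assms by simp
    have "((\<lambda>x. ln (cosh x)) has_real_derivative tanh x) (at x)" for x :: real
      using cosh_real_pos[of x] by (auto intro!: derivative_eq_intros simp: tanh_def field_simps)
    then have "\<exists>z>u. z < v \<and> ln (cosh v) - ln (cosh u) = (v - u) * tanh z"
      using \<open>u < v\<close> by (intro MVT2) auto
    then obtain z where z: "u < z" "z < v" "ln (cosh v) - ln (cosh u) = (v - u) * tanh z" by auto
    moreover have "ln (cosh v / cosh u) = ln (cosh v) - ln (cosh u)"
      by (simp add: ln_div)
    moreover have "(v - u) * tanh u \<le> (v - u) * tanh z" "(v - u) * tanh z \<le> (v - u) * tanh v"
      using z by (auto intro!: mult_left_mono)
    ultimately show ?thesis by (simp add: mult.commute)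
  qed simp
  then have 1: "tanh u * (v - u) \<le> ln (cosh v / cosh u)" and 3: "ln (cosh v / cosh u) \<le> tanh v * (v - u)"
    by auto
  show "tanh u * (v - u) \<le> ln (cosh v / cosh u)" by (rule 1)
  have "(tanh v - tanh u) * (v - u) \<le> (v - u) * (v - u)"
    using tanh_diff_le[OF assms] assms by (intro mult_right_mono) auto
  then show "ln (cosh v / cosh u) \<le> tanh u * (v - u) + (v - u)\<^sup>2"
    using 3 by (simp add: algebra_simps power2_eq_square)
qed

section \<open>Product measures of independent spins\<close>

definition spin_prod :: "(nat \<Rightarrow> real) \<Rightarrow> (nat \<Rightarrow> real) measure" where
  "spin_prod b = PiM {1..} (\<lambda>i. spin_measure (b i))"

lemma \<mu>_eq_spin_prod: "\<mu> \<gamma> = spin_prod (zeta_part \<gamma>)"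
  by (simp add: \<mu>_def spin_prod_def)

lemma \<mu>_tilde_eq_spin_prod: "\<mu>_tilde \<gamma> = spin_prod (\<lambda>_. zeta_sum \<gamma>)"
  by (simp add: \<mu>_tilde_def spin_prod_def)

lemma \<rho>_eq_spin_prod: "\<rho> = spin_prod (\<lambda>_. 0)"
  by (simp add: \<rho>_def spin_prod_def spin_measure_def)

lemma sets_spin_measure: "sets (spin_measure b) = Pow spins"
  by (simp add: spin_measure_def sets_point_measure)

lemma space_spin_measure: "space (spin_measure b) = spins"
  by (simp add: spin_measure_def space_point_measure)

lemma borel_measurable_spin_measure: "f \<in> borel_measurable (spin_measure b)"
  by (simp add: spin_measure_def)

lemma finite_spins: "finite spins"
  by (simp add: spins_def)

lemma sets_spin_prod: "sets (spin_prod b) = sets (PiM {1..} (\<lambda>_. count_space spins))"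
  unfolding spin_prod_def
  by (intro sets_PiM_cong refl) (simp add: sets_spin_measure)

lemma space_spin_prod: "space (spin_prod b) = PiE {1..} (\<lambda>_. spins)"
  by (simp add: spin_prod_def space_PiM space_spin_measure)

lemma prob_space_spin_prod: "prob_space (spin_prod b)"
  unfolding spin_prod_def by (intro prob_space_PiM prob_space_spin_measure)

lemma integral_spin_measure:
  "integral\<^sup>L (spin_measure b) f = (f 1 * exp b + f (- 1) * exp (- b)) / (2 * cosh b)" for f :: "real \<Rightarrow> real"
  unfolding spin_measure_def
  by (subst lebesgue_integral_point_measure_finite) (simp_all add: spins_def add_divide_distrib mult.commute)

lemma integrable_spin_measure: "integrable (spin_measure b) f" for f :: "real \<Rightarrow> real"
  unfolding spin_measure_def by (rule integrable_point_measure_finite) (simp add: finite_spins)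

lemma nn_integral_spin_measure:
  assumes "\<And>s. s \<in> spins \<Longrightarrow> 0 \<le> f s"
  shows "(\<integral>\<^sup>+s. ennreal (f s) \<partial>spin_measure b) =
    ennreal ((f 1 * exp b + f (- 1) * exp (- b)) / (2 * cosh b))"
proof -
  have "AE s in spin_measure b. 0 \<le> f s"
    using assms by (auto simp: space_spin_measure intro!: AE_I2)
  then show ?thesis
    using nn_integral_eq_integral[OF integrable_spin_measure[of b f]] by (simp add: integral_spin_measure)
qed

text \<open>Index 0 is not a site; extensionality makes that coordinate constant, so the rule holds
  for every index and can be used without a side condition.\<close>

lemma measurable_spin_component [measurable]: "(\<lambda>x. x i) \<in> borel_measurable (spin_prod b)"
proof (cases "i \<in> {1..}")
  case True
  show ?thesis
    unfolding spin_prod_def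
    by (rule measurable_compose[OF measurable_component_singleton[OF True] borel_measurable_spin_measure])
next
  case False
  then have "(\<lambda>x. x i) \<in> borel_measurable (spin_prod b) \<longleftrightarrow>
      (\<lambda>_. undefined :: real) \<in> borel_measurable (spin_prod b)"
    by (intro measurable_cong) (auto simp: space_spin_prod PiE_def extensional_def)
  then show ?thesis by simp
qed

lemma AE_spin_prod_in_spins: "AE x in spin_prod b. \<forall>i\<ge>1. x i \<in> spins"
  by (rule AE_I2) (auto simp: space_spin_prod)

lemma distr_spin_component:
  "1 \<le> i \<Longrightarrow> distr (spin_prod b) (spin_measure (b i)) (\<lambda>x. x i) = spin_measure (b i)"
  unfolding spin_prod_def by (rule distr_PiM_component) (auto intro: prob_space_spin_measure)

lemma measurable_spin_component': "1 \<le> i \<Longrightarrow> (\<lambda>x. x i) \<in> measurable (spin_prod b) (spin_measure (b i))"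
  unfolding spin_prod_def by (rule measurable_component_singleton) simp

lemma integral_spin_component:
  fixes f :: "real \<Rightarrow> real"
  assumes "1 \<le> i"
  shows "(\<integral>x. f (x i) \<partial>spin_prod b) = (f 1 * exp (b i) + f (- 1) * exp (- b i)) / (2 * cosh (b i))"
  using integral_distr[OF measurable_spin_component'[OF assms, of b] borel_measurable_spin_measure[of f]]
  by (simp add: distr_spin_component[OF assms] integral_spin_measure)

lemma integrable_spin_component:
  fixes f :: "real \<Rightarrow> real"
  assumes "1 \<le> i"
  shows "integrable (spin_prod b) (\<lambda>x. f (x i))"
  using integrable_distr_eq[OF measurable_spin_component'[OF assms, of b] borel_measurable_spin_measure[of f]]
  by (simp add: distr_spin_component[OF assms] integrable_spin_measure)

lemma nn_integral_spin_component:
  assumes "1 \<le> i"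
  shows "(\<integral>\<^sup>+x. f (x i) \<partial>spin_prod b) = (\<integral>\<^sup>+s. f s \<partial>spin_measure (b i))"
  using nn_integral_distr[OF measurable_spin_component'[OF assms, of b], of f]
  by (simp add: distr_spin_component[OF assms] borel_measurable_spin_measure)

text \<open>Independence amounts to the joint law being the product of the marginals. Here the joint
  law is the measure itself, since restriction to \<open>{1..}\<close> does not change extensional
  configurations.\<close>

lemma indep_vars_spin_component:
  fixes f :: "nat \<Rightarrow> real \<Rightarrow> real"
  shows "prob_space.indep_vars (spin_prod b) (\<lambda>_. borel) (\<lambda>i x. f i (x i)) {1..}"
proof -
  interpret prob_space "spin_prod b" by (rule prob_space_spin_prod)
  have "distr (spin_prod b) (PiM {1..} (\<lambda>i. spin_measure (b i))) (\<lambda>x. \<lambda>i\<in>{1..}. x i) =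
      distr (spin_prod b) (spin_prod b) (\<lambda>x. x)"
    by (intro distr_cong) (auto simp: spin_prod_def space_PiM)
  also have "\<dots> = PiM {1..} (\<lambda>i. spin_measure (b i))"
    by (simp add: distr_id spin_prod_def)
  also have "\<dots> = (\<Pi>\<^sub>M i\<in>{1..}. distr (spin_prod b) (spin_measure (b i)) (\<lambda>x. x i))"
    by (rule PiM_cong) (simp_all add: distr_spin_component)
  finally have "indep_vars (\<lambda>i. spin_measure (b i)) (\<lambda>i x. x i) {1..}"
    using measurable_spin_component' by (subst indep_vars_iff_distr_eq_PiM') auto
  then show ?thesis
    by (rule indep_vars_compose2) (rule borel_measurable_spin_measure)
qed

text \<open>Independence factorises the integral and each factor is a two-point sum. It yields both
  the second moments and the cylinder masses of the finite-volume densities, free of integrability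
  conditions.\<close>

lemma nn_integral_prod_spin:
  assumes "finite J" "J \<subseteq> {1..}" "\<And>i s. i \<in> J \<Longrightarrow> 0 \<le> f i s"
  shows "(\<integral>\<^sup>+x. ennreal (\<Prod>i\<in>J. f i (x i)) \<partial>spin_prod b) =
    (\<Prod>i\<in>J. ennreal ((f i 1 * exp (b i) + f i (- 1) * exp (- b i)) / (2 * cosh (b i))))"
proof -
  interpret prob_space "spin_prod b" by (rule prob_space_spin_prod)
  have ind: "indep_vars (\<lambda>_. borel) (\<lambda>i x. ennreal (f i (x i))) J"
    by (rule indep_vars_compose2[OF indep_vars_subset[OF indep_vars_spin_component assms(2)]]) measurable
  have "(\<integral>\<^sup>+x. ennreal (\<Prod>i\<in>J. f i (x i)) \<partial>spin_prod b) =
      (\<integral>\<^sup>+x. (\<Prod>i\<in>J. ennreal (f i (x i))) \<partial>spin_prod b)"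
    using assms(3) by (simp add: prod_ennreal)
  also have "\<dots> = (\<Prod>i\<in>J. \<integral>\<^sup>+x. ennreal (f i (x i)) \<partial>spin_prod b)"
    by (rule indep_vars_nn_integral[OF assms(1) ind]) simp
  also have "\<dots> = (\<Prod>i\<in>J. ennreal ((f i 1 * exp (b i) + f i (- 1) * exp (- b i)) / (2 * cosh (b i))))"
  proof (rule prod.cong[OF refl])
    fix i assume i: "i \<in> J"
    then have "1 \<le> i" using assms(2) by auto
    then show "(\<integral>\<^sup>+x. ennreal (f i (x i)) \<partial>spin_prod b) =
        ennreal ((f i 1 * exp (b i) + f i (- 1) * exp (- b i)) / (2 * cosh (b i)))"
      using nn_integral_spin_measure[of "f i" "b i"] assms(3)[OF i]
        nn_integral_spin_component[of i b "\<lambda>s. ennreal (f i s)"] by simp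
  qed
  finally show ?thesis .
qed

lemma expectation_spin: "1 \<le> i \<Longrightarrow> (\<integral>x. x i \<partial>spin_prod b) = tanh (b i)"
  using integral_spin_component[of i b "\<lambda>s. s"]
  by (simp add: tanh_def sinh_def cosh_def scaleR_conv_of_real field_simps)

lemma expectation_centred_spin:
  assumes "1 \<le> i"
  shows "(\<integral>x. a * (x i - tanh (b i)) \<partial>spin_prod b) = 0"
    and "(\<integral>x. (a * (x i - t))\<^sup>2 \<partial>spin_prod b) = a\<^sup>2 * (1 - 2 * t * tanh (b i) + t\<^sup>2)"
proof -
  interpret prob_space "spin_prod b" by (rule prob_space_spin_prod)
  show "(\<integral>x. a * (x i - tanh (b i)) \<partial>spin_prod b) = 0"
    using integrable_spin_component[OF assms, of b "\<lambda>s. s"] assms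
    by (simp add: expectation_spin prob_space)
  have "(\<integral>x. (a * (x i - t))\<^sup>2 \<partial>spin_prod b) = 
      (\<integral>x. a\<^sup>2 * (1 + t\<^sup>2) - 2 * t * a\<^sup>2 * x i \<partial>spin_prod b)"
  proof (rule integral_cong_AE)
    show "AE x in spin_prod b. (a * (x i - t))\<^sup>2 = a\<^sup>2 * (1 + t\<^sup>2) - 2 * t * a\<^sup>2 * x i"
      using AE_spin_prod_in_spins[of b]
    proof eventually_elim
      case (elim x)
      \<comment> \<open>Spins square to 1, so the square is affine in \<open>x i\<close> and its
        integral needs only the mean.\<close>
      then have "(x i)\<^sup>2 = 1" using assms by (auto simp: spins_def)
      moreover have "(a * (x i - t))\<^sup>2 = a\<^sup>2 * (x i)\<^sup>2 + a\<^sup>2 * t\<^sup>2 - 2 * t * a\<^sup>2 * x i"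
        by (simp add: power2_eq_square algebra_simps)
      ultimately show ?case by (simp add: distrib_left)
    qed
  qed (auto intro!: borel_measurable_power borel_measurable_times borel_measurable_diff)
  also have "\<dots> = a\<^sup>2 * (1 + t\<^sup>2) - 2 * t * a\<^sup>2 * tanh (b i)"
  proof -
    have "integrable (spin_prod b) (\<lambda>x. 2 * t * a\<^sup>2 * x i)"
      by (intro integrable_mult_right integrable_spin_component[OF assms, where f = "\<lambda>s. s"])
    then show ?thesis
      by (subst Bochner_Integration.integral_diff)
        (auto simp: prob_space expectation_spin[OF assms])
  qed
  also have "\<dots> = a\<^sup>2 * (1 - 2 * t * tanh (b i) + t\<^sup>2)"
    by (simp add: algebra_simps)
  finally show "(\<integral>x. (a * (x i - t))\<^sup>2 \<partial>spin_prod b) = a\<^sup>2 * (1 - 2 * t * tanh (b i) + t\<^sup>2)" .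
qed

text \<open>At t = tanh (b i) the second moment is a^2 (1 - t^2), hence a bound uniform in the
  field.\<close>

lemma variance_centred_spin_le:
  assumes "1 \<le> i"
  shows "(\<integral>x. (a * (x i - tanh (b i)))\<^sup>2 \<partial>spin_prod b) \<le> a\<^sup>2"
  by (subst expectation_centred_spin(2)[OF assms]) (auto simp: power2_eq_square intro!: mult_left_le)

lemma AE_summable_centred_spins:
  assumes "summable (\<lambda>i. (a (Suc i))\<^sup>2)"
  shows "AE x in spin_prod b. summable (\<lambda>i. a (Suc i) * (x (Suc i) - tanh (b (Suc i))))"
proof -
  interpret prob_space "spin_prod b" by (rule prob_space_spin_prod)
  let ?X = "\<lambda>i x. a i * (x i - tanh (b i))"
  have var: "expectation (\<lambda>x. (?X (Suc i) x)\<^sup>2) \<le> (a (Suc i))\<^sup>2" for i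
    by (rule variance_centred_spin_le) simp
  show ?thesis
  proof (rule AE_convergent_sum_indep)
    show "indep_vars (\<lambda>_. borel) (\<lambda>i. ?X (Suc i)) UNIV"
      by (rule indep_vars_reindex[OF indep_vars_spin_component[of b "\<lambda>i s. a i * (s - tanh (b i))"]])
        auto
    show "integrable (spin_prod b) (\<lambda>x. (?X (Suc i) x)\<^sup>2)" for i
      by (rule integrable_spin_component) simp
    show "expectation (?X (Suc i)) = 0" for i
      by (rule expectation_centred_spin(1)) simp
    show "summable (\<lambda>i. expectation (\<lambda>x. (?X (Suc i) x)\<^sup>2))"
      by (rule summable_comparison_test'[OF assms, of 0]) (use var in auto)
  qed
qed

section \<open>Mutual singularity\<close>

text \<open>Borel-Cantelli with errors 2^(-k): M-almost every point lies in only finitely many of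
  the chosen sets, N-almost every point in all but finitely many. The set \<open>C\<close> of points
  of the second kind separates the measures.\<close>

lemma mutually_singularI:
  assumes M: "prob_space M" and N: "prob_space N" and sets: "sets N = sets M"
    and B: "\<And>e. 0 < e \<Longrightarrow> \<exists>B\<in>sets M. measure M B \<le> e \<and> measure N (space N - B) \<le> e"
  shows "mutually_singular M N"
proof -
  interpret M: prob_space M by fact
  interpret N: prob_space N by fact
  have space: "space N = space M"
    by (rule sets_eq_imp_space_eq[OF sets])
  have "\<exists>B\<in>sets M. measure M B \<le> (1/2)^k \<and> measure N (space N - B) \<le> (1/2)^k" for k :: nat
    by (rule B) simp
  then obtain B where B: "\<And>k::nat. B k \<in> sets M" "\<And>k. measure M (B k) \<le> (1/2)^k"
    "\<And>k. measure N (space N - B k) \<le> (1/2)^k"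
    by metis
  have [measurable]: "B k \<in> sets M" "B k \<in> sets N" for k
    using B(1) sets by auto
  have geo: "summable (\<lambda>k. (1/2 :: real)^k)"
    by (rule summable_geometric) simp
  define C where "C = {x\<in>space M. eventually (\<lambda>k. x \<in> B k) sequentially}"
  have C: "C \<in> sets M"
    unfolding C_def by measurable
  have "AE x in M. eventually (\<lambda>k. x \<in> space M - B k) sequentially"
    by (rule borel_cantelli_AE1)
      (auto intro!: summable_comparison_test'[OF geo, of 0] simp: B(2) M.emeasure_eq_measure)
  then have "AE x in M. x \<notin> C"
  proof eventually_elim
    case (elim x)
    show ?case
    proof
      assume "x \<in> C"
      then have "eventually (\<lambda>k. x \<in> B k) sequentially" by (simp add: C_def)
      with elim have "eventually (\<lambda>k. False) sequentially"
        by eventually_elim simp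
      then show False by simp
    qed
  qed
  then have 1: "C \<in> null_sets M"
    using C by (simp add: AE_iff_null_sets)
  have "AE x in N. eventually (\<lambda>k. x \<in> space N - (space N - B k)) sequentially"
    by (rule borel_cantelli_AE1)
      (auto intro!: summable_comparison_test'[OF geo, of 0] simp: B(3) N.emeasure_eq_measure)
  then have "AE x in N. x \<notin> space N - C"
  proof eventually_elim
    case (elim x)
    then have "eventually (\<lambda>k. x \<in> B k) sequentially"
      by eventually_elim simp
    then show ?case by (simp add: C_def space)
  qed
  moreover have "space N - C \<in> sets N"
    using C sets by auto
  ultimately have "space N - C \<in> null_sets N"
    by (subst AE_iff_null_sets) auto
  with 1 show ?thesis
    unfolding mutually_singular_def by blast
qed

text \<open>A large final partial sum is a special case of some partial sum being large, so the
  maximal inequality doubles as Chebyshev's inequality.\<close>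

lemma spin_prod_chebyshev:
  assumes "0 < \<epsilon>"
  shows "measure (spin_prod b) {x\<in>space (spin_prod b). \<epsilon> \<le> \<bar>\<Sum>i=1..n. d i * (x i - tanh (b i))\<bar>}
    \<le> (\<Sum>i=1..n. (d i)\<^sup>2) / \<epsilon>\<^sup>2"
proof -
  interpret prob_space "spin_prod b" by (rule prob_space_spin_prod)
  let ?X = "\<lambda>i x. d i * (x i - tanh (b i))"
  have var: "expectation (\<lambda>x. (?X (Suc i) x)\<^sup>2) \<le> (d (Suc i))\<^sup>2" for i
    by (rule variance_centred_spin_le) simp
  have "prob {x\<in>space (spin_prod b). \<epsilon> \<le> \<bar>\<Sum>i=1..n. ?X i x\<bar>}
      \<le> prob {x\<in>space (spin_prod b). \<exists>k\<le>n. \<epsilon> \<le> \<bar>\<Sum>i<k. ?X (Suc i) x\<bar>}"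
    by (rule finite_measure_mono) (auto simp: sum.atLeast1_atMost_eq)
  also have "\<dots> \<le> (\<Sum>i<n. expectation (\<lambda>x. (?X (Suc i) x)\<^sup>2)) / \<epsilon>\<^sup>2"
  proof (rule kolmogorov_maximal_inequality)
    show "indep_vars (\<lambda>_. borel) (\<lambda>i. ?X (Suc i)) UNIV"
      by (rule indep_vars_reindex[OF indep_vars_spin_component[of b "\<lambda>i s. d i * (s - tanh (b i))"]])
        auto
    show "integrable (spin_prod b) (\<lambda>x. (?X (Suc i) x)\<^sup>2)" for i
      by (rule integrable_spin_component) simp
    show "expectation (?X (Suc i)) = 0" for i
      by (rule expectation_centred_spin(1)) simp
  qed fact
  also have "\<dots> \<le> (\<Sum>i=1..n. (d i)\<^sup>2) / \<epsilon>\<^sup>2"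
    unfolding One_nat_def sum.atLeast1_atMost_eq by (rule divide_right_mono[OF sum_mono[OF var]]) simp
  finally show ?thesis .
qed

text \<open>Both sides are symmetric in \<open>u\<close> and \<open>v\<close>, which reduces to u
  \<le> v. It bounds the drift of the separating statistic below by a multiple of its variance
  bound.\<close>

lemma tanh_diff_times_diff_ge:
  fixes u v Z :: real
  assumes "\<bar>u\<bar> \<le> Z" "\<bar>v\<bar> \<le> Z"
  shows "(v - u)\<^sup>2 / (cosh Z)\<^sup>2 \<le> (v - u) * (tanh v - tanh u)"
proof -
  have *: "(v - u)\<^sup>2 / (cosh Z)\<^sup>2 \<le> (v - u) * (tanh v - tanh u)"
    if "u \<le> v" "\<bar>u\<bar> \<le> Z" "\<bar>v\<bar> \<le> Z" for u v :: real
    using mult_left_mono[OF tanh_diff_ge[OF that], of "v - u"] that by (simp add: power2_eq_square)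
  show ?thesis
    using *[of u v] *[of v u] assms by (cases "u \<le> v") (auto simp: power2_commute algebra_simps)
qed

lemma sum_at_top_of_not_summable:
  fixes f :: "nat \<Rightarrow> real"
  assumes "\<And>i. 0 \<le> f (Suc i)" "\<not> summable (\<lambda>i. f (Suc i))"
  shows "filterlim (\<lambda>n. \<Sum>i=1..n. f i) at_top sequentially"
proof -
  have inc: "incseq (\<lambda>n. \<Sum>i<n. f (Suc i))"
    using assms(1) by (intro incseq_SucI) simp
  have "\<exists>n. c \<le> (\<Sum>i<n. f (Suc i))" for c
  proof (rule ccontr)
    assume "\<nexists>n. c \<le> (\<Sum>i<n. f (Suc i))"
    then have lt: "(\<Sum>i<n. f (Suc i)) < c" for n
      by (simp add: not_le)
    have "summable (\<lambda>i. f (Suc i))"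
      by (rule bounded_imp_summable[of _ c, OF assms(1)])
        (use lt[of "Suc _"] in \<open>simp only: lessThan_Suc_atMost less_imp_le\<close>)
    then show False using assms(2) by simp
  qed
  then have "eventually (\<lambda>n. c \<le> (\<Sum>i<n. f (Suc i))) sequentially" for c
    using inc unfolding eventually_sequentially incseq_def by (meson order_trans)
  then show ?thesis
    unfolding One_nat_def sum.atLeast1_atMost_eq filterlim_at_top by simp
qed

text \<open>With weights c_i - b_i the statistic \<open>T\<close> has mean 0 under b, mean at least
  \<kappa> V under c, and variance at most V under both. The midpoint \<kappa> V / 2 as threshold
  leaves errors of at most 4 / (\<kappa>^2 V), which vanish as V grows. Boundedness of the fields
  gives one \<kappa> > 0 for all sites.\<close>

lemma spin_prod_mutually_singular:
  assumes b: "\<And>i. \<bar>b i\<bar> \<le> Z" and c: "\<And>i. \<bar>c i\<bar> \<le> Z"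
    and div: "\<not> summable (\<lambda>i. (c (Suc i) - b (Suc i))\<^sup>2)"
  shows "mutually_singular (spin_prod b) (spin_prod c)"
proof (rule mutually_singularI[OF prob_space_spin_prod prob_space_spin_prod])
  show sets: "sets (spin_prod c) = sets (spin_prod b)"
    by (simp add: sets_spin_prod)
  have space: "space (spin_prod c) = space (spin_prod b)"
    by (simp add: space_spin_prod)
  interpret b: prob_space "spin_prod b" by (rule prob_space_spin_prod)
  interpret c: prob_space "spin_prod c" by (rule prob_space_spin_prod)
  fix e :: real assume e: "0 < e"
  define \<kappa> where "\<kappa> = 1 / (cosh Z)\<^sup>2"
  have \<kappa>: "0 < \<kappa>" by (simp add: \<kappa>_def)
  define d where "d i = c i - b i" for i
  define V where "V n = (\<Sum>i=1..n. (d i)\<^sup>2)" for n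
  have "filterlim V at_top sequentially"
    unfolding V_def using div by (intro sum_at_top_of_not_summable) (auto simp: d_def)
  \<comment> \<open>This size of V makes the Chebyshev error 4 / (\<kappa>^2 V) at most
    \<open>e\<close>.\<close>
  then have "eventually (\<lambda>n. 4 / (\<kappa>\<^sup>2 * e) + 1 \<le> V n) sequentially"
    by (simp add: filterlim_at_top)
  then obtain n where n: "4 / (\<kappa>\<^sup>2 * e) + 1 \<le> V n"
    by (auto simp: eventually_sequentially)
  have "0 < 4 / (\<kappa>\<^sup>2 * e)" using e \<kappa> by simp
  then have V0: "0 < V n" using n by linarith
  have "4 / (\<kappa>\<^sup>2 * e) \<le> V n" using n by linarith
  then have small: "V n / (\<kappa> * V n / 2)\<^sup>2 \<le> e"
    using V0 e \<kappa> by (simp add: power2_eq_square field_simps)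
  have pos: "0 < \<kappa> * V n / 2" using V0 \<kappa> by simp
  define T where "T x = (\<Sum>i=1..n. d i * (x i - tanh (b i)))" for x
  define B where "B = {x\<in>space (spin_prod b). \<kappa> * V n / 2 \<le> T x}"
  have meas: "T \<in> borel_measurable (spin_prod b)"
    unfolding T_def by (intro borel_measurable_sum borel_measurable_times borel_measurable_diff
        measurable_spin_component borel_measurable_const)
  have B: "B \<in> sets (spin_prod b)"
    unfolding B_def using meas by measurable
  have "b.prob B \<le> b.prob {x\<in>space (spin_prod b). \<kappa> * V n / 2 \<le> \<bar>T x\<bar>}"
    using meas by (intro b.finite_measure_mono) (auto simp: B_def)
  also have "\<dots> \<le> V n / (\<kappa> * V n / 2)\<^sup>2"
    unfolding T_def V_def[symmetric] by (subst V_def) (rule spin_prod_chebyshev[OF pos])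
  finally have 1: "b.prob B \<le> e" using small by simp
  have drift: "\<kappa> * V n \<le> (\<Sum>i=1..n. d i * (tanh (c i) - tanh (b i)))"
    unfolding V_def sum_distrib_left
    using tanh_diff_times_diff_ge[OF b c] by (intro sum_mono) (simp add: d_def \<kappa>_def)
  \<comment> \<open>Recentring at the means under \<open>c\<close>: if T x < \<kappa> V / 2 while
    the drift is at least \<kappa> V, the centred sum is below - \<kappa> V / 2.\<close>
  have T: "T x = (\<Sum>i=1..n. d i * (x i - tanh (c i))) + (\<Sum>i=1..n. d i * (tanh (c i) - tanh (b i)))" for x
    unfolding T_def sum.distrib[symmetric] by (intro sum.cong) (auto simp: algebra_simps)
  have "c.prob (space (spin_prod c) - B) \<le>
      c.prob {x\<in>space (spin_prod c). \<kappa> * V n / 2 \<le> \<bar>\<Sum>i=1..n. d i * (x i - tanh (c i))\<bar>}"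
  proof (rule c.finite_measure_mono)
    show "space (spin_prod c) - B \<subseteq>
        {x\<in>space (spin_prod c). \<kappa> * V n / 2 \<le> \<bar>\<Sum>i=1..n. d i * (x i - tanh (c i))\<bar>}"
      using drift T by (auto simp: B_def space)
    have "(\<lambda>x. \<Sum>i=1..n. d i * (x i - tanh (c i))) \<in> borel_measurable (spin_prod c)"
      by (intro borel_measurable_sum borel_measurable_times borel_measurable_diff
        measurable_spin_component borel_measurable_const)
    then show "{x\<in>space (spin_prod c). \<kappa> * V n / 2 \<le> \<bar>\<Sum>i=1..n. d i * (x i - tanh (c i))\<bar>}
        \<in> sets (spin_prod c)"
      by measurable
  qed
  also have "\<dots> \<le> V n / (\<kappa> * V n / 2)\<^sup>2"
    by (subst V_def) (rule spin_prod_chebyshev[OF pos])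
  finally have 2: "c.prob (space (spin_prod c) - B) \<le> e" using small by simp
  show "\<exists>B\<in>sets (spin_prod b). b.prob B \<le> e \<and> c.prob (space (spin_prod c) - B) \<le> e"
    using B 1 2 by blast
qed

section \<open>Absolute continuity\<close>

text \<open>Truncation: \<open>g \<le> min g K + g\<^sup>2 / K\<close>, and dominated convergence applies to \<open>min g K\<close>.\<close>

lemma nn_integral_limit_L2_bounded:
  fixes g :: "nat \<Rightarrow> 'a \<Rightarrow> real" and h :: "'a \<Rightarrow> ennreal"
  assumes "finite_measure M"
    and g [measurable]: "\<And>n. g n \<in> borel_measurable M" and h [measurable]: "h \<in> borel_measurable M"
    and g0: "\<And>n x. 0 \<le> g n x"
    and lim: "AE x in M. (\<lambda>n. ennreal (g n x)) \<longlonglongrightarrow> h x"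
    and L2: "\<And>n. (\<integral>\<^sup>+x. ennreal ((g n x)\<^sup>2) \<partial>M) \<le> ennreal B"
    and q: "eventually (\<lambda>n. (\<integral>\<^sup>+x. ennreal (g n x) \<partial>M) = q) sequentially"
  shows "(\<integral>\<^sup>+x. h x \<partial>M) = q"
proof (rule antisym)
  interpret finite_measure M by fact
  \<comment> \<open>Fatou's lemma gives the bound from above; only a loss of mass remains to be
    excluded.\<close>
  have "(\<integral>\<^sup>+x. h x \<partial>M) = (\<integral>\<^sup>+x. liminf (\<lambda>n. ennreal (g n x)) \<partial>M)"
    using lim by (intro nn_integral_cong_AE) (auto elim!: eventually_mono dest: lim_imp_Liminf[rotated])
  also have "\<dots> \<le> liminf (\<lambda>n. \<integral>\<^sup>+x. ennreal (g n x) \<partial>M)"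
    by (rule nn_integral_liminf) measurable
  also have "\<dots> = liminf (\<lambda>n. q)"
    by (rule Liminf_eq[OF q])
  finally show "(\<integral>\<^sup>+x. h x \<partial>M) \<le> q"
    by (simp add: Liminf_const)
  show "q \<le> (\<integral>\<^sup>+x. h x \<partial>M)"
  proof (rule ennreal_le_epsilon)
    fix e :: real assume e: "0 < e"
    \<comment> \<open>Makes the truncation error B / K at most \<open>e\<close>, with K positive
      whatever the sign of \<open>B\<close>.\<close>
    define K where "K = (\<bar>B\<bar> + 1) / e"
    have K: "0 < K" using e by (simp add: K_def)
    have "(\<lambda>n. \<integral>\<^sup>+x. min (ennreal (g n x)) (ennreal K) \<partial>M) \<longlonglongrightarrow> (\<integral>\<^sup>+x. min (h x) (ennreal K) \<partial>M)"
    proof (rule nn_integral_dominated_convergence[where w = "\<lambda>_. ennreal K"])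
      show "(\<integral>\<^sup>+x. ennreal K \<partial>M) < \<infinity>"
        by (simp add: ennreal_mult_less_top emeasure_eq_measure)
      show "AE x in M. (\<lambda>n. min (ennreal (g n x)) (ennreal K)) \<longlonglongrightarrow> min (h x) (ennreal K)"
        using lim by eventually_elim (intro tendsto_min tendsto_const)
    qed auto
    then have "(\<lambda>n. (\<integral>\<^sup>+x. min (ennreal (g n x)) (ennreal K) \<partial>M) + ennreal e)
        \<longlonglongrightarrow> (\<integral>\<^sup>+x. min (h x) (ennreal K) \<partial>M) + ennreal e"
      by (intro tendsto_add tendsto_const)
    moreover have "eventually (\<lambda>n. q \<le> (\<integral>\<^sup>+x. min (ennreal (g n x)) (ennreal K) \<partial>M) + ennreal e) sequentially"
      using q
    proof eventually_elim
      case (elim n)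
      have "q = (\<integral>\<^sup>+x. ennreal (g n x) \<partial>M)" using elim by simp
      also have "\<dots> \<le> (\<integral>\<^sup>+x. min (ennreal (g n x)) (ennreal K) + ennreal (1 / K) * ennreal ((g n x)\<^sup>2) \<partial>M)"
      proof (rule nn_integral_mono)
        fix x
        have "g n x \<le> min (g n x) K + 1 / K * (g n x)\<^sup>2"
        proof (cases "g n x \<le> K")
          case False
          then have "K * g n x \<le> g n x * g n x"
            using g0[of n x] by (intro mult_right_mono) auto
          then have "g n x \<le> 1 / K * (g n x)\<^sup>2"
            using K by (simp add: power2_eq_square field_simps)
          then show ?thesis using False K by simp
        qed (use K in simp)
        then have "ennreal (g n x) \<le> ennreal (min (g n x) K + 1 / K * (g n x)\<^sup>2)"
          by (rule ennreal_leI)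
        also have "\<dots> = ennreal (min (g n x) K) + ennreal (1 / K) * ennreal ((g n x)\<^sup>2)"
          using K g0[of n x] ennreal_mult[of "1 / K" "(g n x)\<^sup>2"] by (simp add: ennreal_plus)
        also have "ennreal (min (g n x) K) = min (ennreal (g n x)) (ennreal K)"
          using K g0[of n x] by (simp add: min_def)
        finally show "ennreal (g n x) \<le> min (ennreal (g n x)) (ennreal K) + ennreal (1 / K) * ennreal ((g n x)\<^sup>2)" .
      qed
      also have "\<dots> = (\<integral>\<^sup>+x. min (ennreal (g n x)) (ennreal K) \<partial>M) +
          ennreal (1 / K) * (\<integral>\<^sup>+x. ennreal ((g n x)\<^sup>2) \<partial>M)"
        by (simp add: nn_integral_add nn_integral_cmult)
      also have "\<dots> \<le> (\<integral>\<^sup>+x. min (ennreal (g n x)) (ennreal K) \<partial>M) + ennreal (1 / K) * ennreal B"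
        by (intro add_left_mono mult_left_mono L2) simp
      also have "ennreal (1 / K) * ennreal B \<le> ennreal e"
      proof -
        have "B * e \<le> (\<bar>B\<bar> + 1) * e" using e by (intro mult_right_mono) auto
        then have "B * e / (\<bar>B\<bar> + 1) \<le> e"
          by (subst pos_divide_le_eq) (simp_all add: mult.commute)
        then have "1 / K * B \<le> e" by (simp add: K_def mult.commute)
        then show ?thesis
          using K by (simp flip: ennreal_mult' add: ennreal_leI)
      qed
      finally show ?case by (simp add: add_left_mono)
    qed
    ultimately have "q \<le> (\<integral>\<^sup>+x. min (h x) (ennreal K) \<partial>M) + ennreal e"
      by (rule tendsto_lowerbound) simp
    also have "\<dots> \<le> (\<integral>\<^sup>+x. h x \<partial>M) + ennreal e"
      by (intro add_right_mono nn_integral_mono) simp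
    finally show "q \<le> (\<integral>\<^sup>+x. h x \<partial>M) + ennreal e" .
  qed
qed

text \<open>ln cosh is compared with its tangent at 0, where the slope tanh vanishes.\<close>

lemma cosh_le_exp_square: "cosh x \<le> exp (x\<^sup>2)" for x :: real
proof -
  have "ln (cosh \<bar>x\<bar>) \<le> x\<^sup>2"
    using ln_cosh_diff_bounds(2)[of 0 "\<bar>x\<bar>"] by simp
  then have "exp (ln (cosh \<bar>x\<bar>)) \<le> exp (x\<^sup>2)"
    by (simp only: exp_le_cancel_iff)
  then show ?thesis by simp
qed

text \<open>The Radon--Nikodym derivative of \<open>spin_measure c\<close> with respect to \<open>spin_measure b\<close>.\<close>

definition spin_ratio :: "real \<Rightarrow> real \<Rightarrow> real \<Rightarrow> real" where
  "spin_ratio b c s = exp (s * (c - b)) * (cosh b / cosh c)"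

lemma spin_ratio_pos: "0 < spin_ratio b c s"
  by (simp add: spin_ratio_def)

lemma spin_ratio_times_exp:
  "spin_ratio b c 1 * exp b / (2 * cosh b) = exp c / (2 * cosh c)"
  "spin_ratio b c (- 1) * exp (- b) / (2 * cosh b) = exp (- c) / (2 * cosh c)"
  by (simp_all add: spin_ratio_def exp_diff exp_minus field_simps)

text \<open>With d = c - b the left side equals cosh (c + d) cosh (c - d) / cosh^2 c, which the
  addition formulas evaluate. The exponential is the form of the bound that multiplies over sites: a
  product of second moments is then controlled by the sum of the squared field differences.\<close>

lemma spin_ratio_second_moment:
  "((spin_ratio b c 1)\<^sup>2 * exp b + (spin_ratio b c (- 1))\<^sup>2 * exp (- b)) / (2 * cosh b)
    \<le> exp (2 * (c - b)\<^sup>2)"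
proof -
  define d where "d = c - b"
  have e: "exp (2 * d + b) + exp (- (2 * d + b)) = 2 * cosh (2 * d + b)"
    by (simp add: cosh_def scaleR_conv_of_real)
  have sq: "(spin_ratio b c 1)\<^sup>2 * exp b + (spin_ratio b c (- 1))\<^sup>2 * exp (- b) =
      (exp (2 * d + b) + exp (- (2 * d + b))) * (cosh b / cosh c)\<^sup>2"
  proof -
    define R where "R = cosh b / cosh c"
    have e1: "(exp d)\<^sup>2 * exp b = exp (2 * d + b)"
      by (simp add: exp_add exp_double)
    have e2: "(exp (- d))\<^sup>2 * exp (- b) = exp (- (2 * d + b))"
      using exp_add[of "2 * (- d)" "- b"] exp_double[of "- d"] by simp
    have ratio: "spin_ratio b c 1 = exp d * R" "spin_ratio b c (- 1) = exp (- d) * R"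
      by (simp_all add: spin_ratio_def d_def R_def)
    show ?thesis
      unfolding ratio power_mult_distrib e1[symmetric] e2[symmetric] R_def[symmetric]
      by (simp only: distrib_right distrib_left ac_simps)
  qed
  have prod: "cosh (2 * d + b) * cosh b = (cosh c)\<^sup>2 + (sinh d)\<^sup>2"
  proof -
    have "2 * d + b = c + d" "c - d = b"
      by (simp_all add: d_def)
    then have "cosh (2 * d + b) * cosh b = cosh (c + d) * cosh (c - d)"
      by (simp only:)
    also have "\<dots> = (cosh c * cosh d)\<^sup>2 - (sinh c * sinh d)\<^sup>2"
      unfolding cosh_add cosh_diff by (simp add: power2_eq_square algebra_simps)
    also have "\<dots> = (cosh c)\<^sup>2 + (sinh d)\<^sup>2"
      by (simp add: power_mult_distrib cosh_square_eq algebra_simps)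
    finally show ?thesis .
  qed
  have "((spin_ratio b c 1)\<^sup>2 * exp b + (spin_ratio b c (- 1))\<^sup>2 * exp (- b)) / (2 * cosh b) =
      cosh (2 * d + b) * cosh b / (cosh c)\<^sup>2"
    unfolding sq e by (simp add: power2_eq_square field_simps)
  also have "\<dots> = 1 + (sinh d)\<^sup>2 / (cosh c)\<^sup>2"
    unfolding prod by (simp add: add_divide_distrib)
  also have "\<dots> \<le> 1 + (sinh d)\<^sup>2"
    using power_mono[OF cosh_real_ge_1[of c], of 2] by (simp add: divide_le_eq mult_le_cancel_left1)
  also have "\<dots> = (cosh d)\<^sup>2"
    by (simp add: cosh_square_eq)
  also have "\<dots> \<le> (exp (d\<^sup>2))\<^sup>2"
    by (intro power_mono cosh_le_exp_square) simp
  also have "\<dots> = exp (2 * (c - b)\<^sup>2)"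
    by (simp add: d_def exp_double)
  finally show ?thesis .
qed

text \<open>A product measure is determined by its cylinders. On a cylinder the finite-volume
  densities integrate to exactly the \<open>c\<close>-mass once \<open>n\<close> covers its sites,
  because every other site contributes a factor 1; the sequence of integrals is eventually constant,
  and only the exchange of limit and integral is at stake.\<close>

lemma spin_prod_eq_density:
  assumes h: "h \<in> borel_measurable (spin_prod b)"
    and lim: "AE x in spin_prod b. (\<lambda>n. ennreal (\<Prod>i=1..n. spin_ratio (b i) (c i) (x i))) \<longlonglongrightarrow> h x"
    and sm: "summable (\<lambda>i. (c (Suc i) - b (Suc i))\<^sup>2)"
  shows "spin_prod c = density (spin_prod b) h"
proof -
  interpret prob_space "spin_measure (c i)" for i by (rule prob_space_spin_measure)
  interpret c: product_prob_space "\<lambda>i. spin_measure (c i)" "{1..}"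
    by unfold_locales
  interpret b: prob_space "spin_prod b" by (rule prob_space_spin_prod)
  have sets: "sets (density (spin_prod b) h) = sets (PiM {1..} (\<lambda>i. spin_measure (c i)))"
    using sets_spin_prod[of b] sets_spin_prod[of c] by (simp add: spin_prod_def)
  have "density (spin_prod b) h = PiM {1..} (\<lambda>i. spin_measure (c i))"
  proof (rule c.PiM_eq[OF sets])
    fix J F assume J: "finite J" "J \<subseteq> {1..}" and F: "\<And>j. j \<in> J \<Longrightarrow> F j \<in> sets (spin_measure (c j))"
    let ?C = "prod_emb {1..} (\<lambda>i. spin_measure (c i)) J (\<Pi>\<^sub>E j\<in>J. F j)"
    have C: "?C \<in> sets (spin_prod b)"
      using sets_PiM_I[OF J, of F "\<lambda>i. spin_measure (c i)"] F sets by simp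
    \<comment> \<open>One-site constraints, equal to 1 at unconstrained sites: they turn the
      indicator of the cylinder into a product over sites.\<close>
    define I where "I i s = (if i \<in> J \<and> s \<notin> F i then 0 else 1 :: real)" for i s
    have I: "I i s \<in> {0, 1}" for i s by (simp add: I_def)
    define r where "r n x = (\<Prod>i=1..n. spin_ratio (b i) (c i) (x i))" for n and x :: "nat \<Rightarrow> real"
    have r0: "0 \<le> r n x" for n x
      unfolding r_def by (intro prod_nonneg less_imp_le[OF spin_ratio_pos])
    have r [measurable]: "r n \<in> borel_measurable (spin_prod b)" for n
      unfolding r_def[abs_def] spin_ratio_def by measurable
    have "emeasure (density (spin_prod b) h) ?C = (\<integral>\<^sup>+x. h x * indicator ?C x \<partial>spin_prod b)"
      by (rule emeasure_density[OF h C])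
    also have "\<dots> = (\<Prod>j\<in>J. emeasure (spin_measure (c j)) (F j))"
    proof (rule nn_integral_limit_L2_bounded[where g = "\<lambda>n x. r n x * indicator ?C x"
          and B = "exp (2 * (\<Sum>i. (c (Suc i) - b (Suc i))\<^sup>2))"])
      show "AE x in spin_prod b. (\<lambda>n. ennreal (r n x * indicator ?C x)) \<longlonglongrightarrow> h x * indicator ?C x"
        using lim
      proof eventually_elim
        case (elim x)
        then show ?case by (cases "x \<in> ?C") (simp_all add: r_def)
      qed
      show "(\<integral>\<^sup>+x. ennreal ((r n x * indicator ?C x)\<^sup>2) \<partial>spin_prod b)
          \<le> ennreal (exp (2 * (\<Sum>i. (c (Suc i) - b (Suc i))\<^sup>2)))" for n
      proof -
        have "(\<integral>\<^sup>+x. ennreal ((r n x * indicator ?C x)\<^sup>2) \<partial>spin_prod b) \<le>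
            (\<integral>\<^sup>+x. ennreal (\<Prod>i=1..n. (spin_ratio (b i) (c i) (x i))\<^sup>2) \<partial>spin_prod b)"
          by (intro nn_integral_mono ennreal_leI)
            (auto simp: r_def power_mult_distrib prod_power_distrib indicator_def intro!: prod_nonneg)
        also have "\<dots> = (\<Prod>i=1..n. ennreal (((spin_ratio (b i) (c i) 1)\<^sup>2 * exp (b i) +
            (spin_ratio (b i) (c i) (- 1))\<^sup>2 * exp (- b i)) / (2 * cosh (b i))))"
          by (rule nn_integral_prod_spin) auto
        also have "\<dots> \<le> (\<Prod>i=1..n. ennreal (exp (2 * (c i - b i)\<^sup>2)))"
          by (intro prod_mono_ennreal ennreal_leI spin_ratio_second_moment)
        also have "\<dots> = ennreal (exp (2 * (\<Sum>i=1..n. (c i - b i)\<^sup>2)))"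
          by (simp add: prod_ennreal exp_sum sum_distrib_left)
        also have "\<dots> \<le> ennreal (exp (2 * (\<Sum>i. (c (Suc i) - b (Suc i))\<^sup>2)))"
          unfolding One_nat_def sum.atLeast1_atMost_eq
          using sum_le_suminf[OF sm, of "{..<n}"] by (intro ennreal_leI) simp
        finally show ?thesis .
      qed
      show "\<forall>\<^sub>F n in sequentially. (\<integral>\<^sup>+x. ennreal (r n x * indicator ?C x) \<partial>spin_prod b) =
          (\<Prod>j\<in>J. emeasure (spin_measure (c j)) (F j))"
      proof -
        obtain m where m: "J \<subseteq> {..m}"
          using J(1) finite_nat_iff_bounded_le by blast
        have "(\<integral>\<^sup>+x. ennreal (r n x * indicator ?C x) \<partial>spin_prod b) =
            (\<Prod>j\<in>J. emeasure (spin_measure (c j)) (F j))" if "m \<le> n" for n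
        proof -
          have Jn: "J \<subseteq> {1..n}" using m that J(2) by force
          have "(\<integral>\<^sup>+x. ennreal (r n x * indicator ?C x) \<partial>spin_prod b) =
              (\<integral>\<^sup>+x. ennreal (\<Prod>i=1..n. spin_ratio (b i) (c i) (x i) * I i (x i)) \<partial>spin_prod b)"
          proof (rule nn_integral_cong)
            fix x assume "x \<in> space (spin_prod b)"
            then have x: "x \<in> PiE {1..} (\<lambda>_. spins)" by (simp add: space_spin_prod)
            have "(\<Prod>i=1..n. I i (x i)) = indicator ?C x"
            proof (cases "x \<in> ?C")
              case True
              then have "I i (x i) = 1" for i
                by (auto simp: I_def prod_emb_iff)
              then show ?thesis using True by simp
            next
              case False
              then obtain j where j: "j \<in> J" "x j \<notin> F j"
                using x by (auto simp: prod_emb_def space_spin_measure PiE_iff)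
              then have "I j (x j) = 0" "j \<in> {1..n}" using Jn by (auto simp: I_def)
              then have "(\<Prod>i=1..n. I i (x i)) = 0"
                by (intro prod_zero) auto
              then show ?thesis using False by simp
            qed
            then show "ennreal (r n x * indicator ?C x) =
                ennreal (\<Prod>i=1..n. spin_ratio (b i) (c i) (x i) * I i (x i))"
              by (simp add: r_def prod.distrib)
          qed
          also have "\<dots> = (\<Prod>i=1..n. ennreal ((spin_ratio (b i) (c i) 1 * I i 1 * exp (b i) +
              spin_ratio (b i) (c i) (- 1) * I i (- 1) * exp (- b i)) / (2 * cosh (b i))))"
            using I by (intro nn_integral_prod_spin)
              (auto simp: I_def intro!: less_imp_le[OF spin_ratio_pos])
          \<comment> \<open>The one-site density turns the weights of field \<open>b i\<close> into
            those of \<open>c i\<close>.\<close>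
          also have "\<dots> = (\<Prod>i=1..n. \<integral>\<^sup>+s. ennreal (I i s) \<partial>spin_measure (c i))"
          proof (rule prod.cong[OF refl])
            fix i
            have "(\<integral>\<^sup>+s. ennreal (I i s) \<partial>spin_measure (c i)) =
                ennreal ((I i 1 * exp (c i) + I i (- 1) * exp (- c i)) / (2 * cosh (c i)))"
              by (rule nn_integral_spin_measure) (simp add: I_def)
            also have "(I i 1 * exp (c i) + I i (- 1) * exp (- c i)) / (2 * cosh (c i)) =
                I i 1 * (exp (c i) / (2 * cosh (c i))) + I i (- 1) * (exp (- c i) / (2 * cosh (c i)))"
              by (simp add: add_divide_distrib)
            also have "\<dots> = (spin_ratio (b i) (c i) 1 * I i 1 * exp (b i) +
                spin_ratio (b i) (c i) (- 1) * I i (- 1) * exp (- b i)) / (2 * cosh (b i))"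
              unfolding spin_ratio_times_exp[of "b i" "c i", symmetric] by (simp add: add_divide_distrib ac_simps)
            finally show "ennreal ((spin_ratio (b i) (c i) 1 * I i 1 * exp (b i) +
                spin_ratio (b i) (c i) (- 1) * I i (- 1) * exp (- b i)) / (2 * cosh (b i))) =
                (\<integral>\<^sup>+s. ennreal (I i s) \<partial>spin_measure (c i))" by simp
          qed
          also have "\<dots> = (\<Prod>j\<in>J. \<integral>\<^sup>+s. ennreal (I j s) \<partial>spin_measure (c j))"
            using Jn prob_space.emeasure_space_1[OF prob_space_spin_measure]
            by (intro prod.mono_neutral_right) (auto simp: I_def)
          also have "\<dots> = (\<Prod>j\<in>J. emeasure (spin_measure (c j)) (F j))"
          proof (rule prod.cong[OF refl])
            fix j assume j: "j \<in> J"
            have "(\<integral>\<^sup>+s. ennreal (I j s) \<partial>spin_measure (c j)) = (\<integral>\<^sup>+s. indicator (F j) s \<partial>spin_measure (c j))"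
              using j by (intro nn_integral_cong) (simp add: I_def indicator_def)
            then show "(\<integral>\<^sup>+s. ennreal (I j s) \<partial>spin_measure (c j)) = emeasure (spin_measure (c j)) (F j)"
              using F[OF j] by simp
          qed
          finally show ?thesis .
        qed
        then show ?thesis
          unfolding eventually_sequentially by blast
      qed
    qed (use h C r r0 in \<open>auto intro: b.finite_measure_axioms\<close>)
    finally show "emeasure (density (spin_prod b) h) ?C = (\<Prod>j\<in>J. emeasure (spin_measure (c j)) (F j))" .
  qed
  then show ?thesis by (simp add: spin_prod_def)
qed

section \<open>Exponentials of spin sums\<close>

lemma exp_ext_lim:
  assumes "f \<longlonglongrightarrow> L"
  shows "convergent (\<lambda>n. ereal (f n))" "exp_ext (lim (\<lambda>n. ereal (f n))) = ennreal (exp L)"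
proof -
  have "(\<lambda>n. ereal (f n)) \<longlonglongrightarrow> ereal L" using assms by simp
  then have "convergent (\<lambda>n. ereal (f n))" "lim (\<lambda>n. ereal (f n)) = ereal L"
    by (auto simp only: convergent_def limI)
  then show "convergent (\<lambda>n. ereal (f n))" "exp_ext (lim (\<lambda>n. ereal (f n))) = ennreal (exp L)"
    by (simp_all add: exp_ext_def)
qed

lemma exp_ext_lim_at_top:
  assumes "filterlim f at_top sequentially"
  shows "convergent (\<lambda>n. ereal (f n))" "exp_ext (lim (\<lambda>n. ereal (f n))) = \<infinity>"
proof -
  have "(\<lambda>n. ereal (f n)) \<longlonglongrightarrow> \<infinity>" using assms by (simp add: tendsto_PInfty_eq_at_top)
  then show "convergent (\<lambda>n. ereal (f n))" "exp_ext (lim (\<lambda>n. ereal (f n))) = \<infinity>"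
    by (auto simp: convergent_def limI exp_ext_def)
qed

lemma exp_ext_lim_at_bot:
  assumes "filterlim f at_bot sequentially"
  shows "convergent (\<lambda>n. ereal (f n))" "exp_ext (lim (\<lambda>n. ereal (f n))) = 0"
proof -
  have "(\<lambda>n. ereal (f n)) \<longlonglongrightarrow> - \<infinity>"
    using assms by (auto simp: tendsto_MInfty filterlim_at_bot_dense)
  then show "convergent (\<lambda>n. ereal (f n))" "exp_ext (lim (\<lambda>n. ereal (f n))) = 0"
    by (auto simp: convergent_def limI exp_ext_def)
qed

text \<open>The offsets \<open>c i\<close> cancel in the difference, so a random sum and its mean
  differ by a convergent sequence. The three lemmas that follow read the behaviour of the sum off
  its mean.\<close>

lemma AE_convergent_centred_spin_sum:
  assumes "summable (\<lambda>i. (a (Suc i))\<^sup>2)"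
  shows "AE x in spin_prod b. \<exists>L.
    (\<lambda>n. (\<Sum>i=1..n. a i * x i + c i) - (\<Sum>i=1..n. a i * tanh (b i) + c i)) \<longlonglongrightarrow> L"
  using AE_summable_centred_spins[OF assms, of b]
proof eventually_elim
  case (elim x)
  have "(\<Sum>i=1..n. a i * x i + c i) - (\<Sum>i=1..n. a i * tanh (b i) + c i) =
      (\<Sum>i<n. a (Suc i) * (x (Suc i) - tanh (b (Suc i))))" for n
    unfolding One_nat_def sum.atLeast1_atMost_eq sum_subtractf[symmetric]
    by (intro sum.cong) (auto simp: algebra_simps)
  then show ?case
    using summable_LIMSEQ[OF elim] by auto
qed

lemma AE_spin_sum_convergent:
  assumes "summable (\<lambda>i. (a (Suc i))\<^sup>2)" "convergent (\<lambda>n. \<Sum>i=1..n. a i * tanh (b i) + c i)"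
  shows "AE x in spin_prod b. \<exists>L. (\<lambda>n. \<Sum>i=1..n. a i * x i + c i) \<longlonglongrightarrow> L"
  using AE_convergent_centred_spin_sum[where b = b and c = c, OF assms(1)]
proof eventually_elim
  case (elim x)
  then obtain L where
    "(\<lambda>n. (\<Sum>i=1..n. a i * x i + c i) - (\<Sum>i=1..n. a i * tanh (b i) + c i)) \<longlonglongrightarrow> L" by blast
  moreover obtain L' where "(\<lambda>n. \<Sum>i=1..n. a i * tanh (b i) + c i) \<longlonglongrightarrow> L'"
    using assms(2) unfolding convergent_def by blast
  ultimately show ?case using tendsto_add by fastforce
qed

lemma AE_spin_sum_at_top:
  assumes "summable (\<lambda>i. (a (Suc i))\<^sup>2)"
    and "filterlim (\<lambda>n. \<Sum>i=1..n. a i * tanh (b i) + c i) at_top sequentially"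
  shows "AE x in spin_prod b. filterlim (\<lambda>n. \<Sum>i=1..n. a i * x i + c i) at_top sequentially"
  using AE_convergent_centred_spin_sum[where b = b and c = c, OF assms(1)]
proof eventually_elim
  case (elim x)
  then obtain L where
    "(\<lambda>n. (\<Sum>i=1..n. a i * x i + c i) - (\<Sum>i=1..n. a i * tanh (b i) + c i)) \<longlonglongrightarrow> L" by blast
  from filterlim_tendsto_add_at_top[OF this assms(2)] show ?case by simp
qed

lemma AE_spin_sum_at_bot:
  assumes "summable (\<lambda>i. (a (Suc i))\<^sup>2)"
    and "filterlim (\<lambda>n. \<Sum>i=1..n. a i * tanh (b i) + c i) at_bot sequentially"
  shows "AE x in spin_prod b. filterlim (\<lambda>n. \<Sum>i=1..n. a i * x i + c i) at_bot sequentially"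
proof -
  have neg: "(\<Sum>i=1..n. - a i * x i + - c i) = - (\<Sum>i=1..n. a i * x i + c i)" for x and n :: nat
    unfolding sum_negf[symmetric] by (intro sum.cong) auto
  have "AE x in spin_prod b. filterlim (\<lambda>n. \<Sum>i=1..n. - a i * x i + - c i) at_top sequentially"
  proof (rule AE_spin_sum_at_top)
    show "summable (\<lambda>i. (- a (Suc i))\<^sup>2)" using assms(1) by simp
    show "filterlim (\<lambda>n. \<Sum>i=1..n. - a i * tanh (b i) + - c i) at_top sequentially"
      using assms(2) unfolding neg[of "\<lambda>i. tanh (b i)"] by (simp only: filterlim_uminus_at_bot)
  qed
  then show ?thesis
    unfolding neg by (simp only: filterlim_uminus_at_bot)
qed

section \<open>Overwriting finitely many spins\<close>

lemma AE_spin_prod_upd: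
  assumes Q: "AE x in spin_prod b. Q x" and j: "1 \<le> j" and s: "s \<in> spins"
  shows "AE x in spin_prod b. Q (x(j := s))"
proof -
  interpret P: prob_space "spin_prod b" by (rule prob_space_spin_prod)
  interpret S: prob_space "spin_measure (b j)" by (rule prob_space_spin_measure)
  interpret J: pair_sigma_finite "spin_measure (b j)" "spin_prod b" ..
  have ins: "insert j {1..} = {1::nat..}" using j by auto
  \<comment> \<open>Resampling site \<open>j\<close> from its own law preserves the product measure;
    \<open>j\<close> is already a site, so inserting it leaves the index set unchanged.\<close>
  have distr: "distr (spin_measure (b j) \<Otimes>\<^sub>M spin_prod b) (spin_prod b) (\<lambda>(t, x). x(j := t)) = spin_prod b"
    using distr_pair_PiM_eq_PiM[of "{1..}" "\<lambda>i. spin_measure (b i)" j] prob_space_spin_measure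
    by (simp only: ins spin_prod_def)
  have meas: "(\<lambda>(t, x). x(j := t)) \<in> measurable (spin_measure (b j) \<Otimes>\<^sub>M spin_prod b) (spin_prod b)"
    unfolding spin_prod_def case_prod_unfold
    by (rule measurable_fun_upd[where J = "{1..}"]) (use j in auto)
  have "AE p in spin_measure (b j) \<Otimes>\<^sub>M spin_prod b. Q (case p of (t, x) \<Rightarrow> x(j := t))"
    using Q by (subst (asm) distr[symmetric]) (rule AE_distrD[OF meas])
  \<comment> \<open>Fubini separates the resampled spin. Both values carry positive mass, so a
    statement for almost every value covers \<open>s\<close>.\<close>
  from J.AE_pair[OF this] have "AE t in spin_measure (b j). AE x in spin_prod b. Q (x(j := t))"
    by simp
  then show ?thesis
    unfolding spin_measure_def AE_point_measure using s by simp
qed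

lemma AE_spin_prod_override:
  assumes Q: "AE x in spin_prod b. Q x" and q: "\<And>i. q i \<in> spins"
  shows "AE x in spin_prod b. Q (\<lambda>i. if i \<in> {1..n} then q i else x i)"
  using Q
proof (induction n arbitrary: Q)
  case (Suc n)
  have eq: "(\<lambda>i. if i \<in> {1..n} then q i else (x(Suc n := q (Suc n))) i) =
      (\<lambda>i. if i \<in> {1..Suc n} then q i else x i)" for x :: "nat \<Rightarrow> real"
    by (auto simp: fun_eq_iff)
  show ?case
    using AE_spin_prod_upd[OF Suc.IH[OF Suc.prems], of "Suc n" "q (Suc n)"] q
    unfolding eq by simp
qed simp

lemma openin_conf_top_cylinder:
  assumes "openin conf_top A" "A \<noteq> {}"
  obtains p m where "\<And>i. p i \<in> spins"
    "\<And>x. x \<in> PiE {1..} (\<lambda>_. spins) \<Longrightarrow> (\<And>i. 1 \<le> i \<Longrightarrow> i \<le> m \<Longrightarrow> x i = p i) \<Longrightarrow> x \<in> A"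
proof -
  obtain y where y: "y \<in> A" using assms by blast
  then obtain V where V: "finite {i \<in> {1..}. V i \<noteq> spins}" "y \<in> PiE {1..} V" "PiE {1..} V \<subseteq> A"
    using assms(1) unfolding conf_top_def openin_product_topology_alt by (auto; blast)
  obtain m where m: "{i \<in> {1..}. V i \<noteq> spins} \<subseteq> {..m}"
    using V(1) finite_nat_iff_bounded_le by blast
  have ys: "y \<in> PiE {1..} (\<lambda>_. spins)"
    using y assms(1) openin_subset topspace_conf_top by fastforce
  show ?thesis
  proof
    \<comment> \<open>The default 1 at index 0, where \<open>y\<close> is undefined, makes the
      pattern a spin at every index.\<close>
    show "(if 1 \<le> i then y i else 1) \<in> spins" for i
      using ys by (auto simp: spins_def PiE_iff)
    fix x assume x: "x \<in> PiE {1..} (\<lambda>_. spins)"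
      and eq: "\<And>i. 1 \<le> i \<Longrightarrow> i \<le> m \<Longrightarrow> x i = (if 1 \<le> i then y i else 1)"
    have "x i \<in> V i" if i: "1 \<le> i" for i
    proof (cases "i \<le> m")
      case True
      then show ?thesis using eq[OF i True] i V(2) by (auto simp: PiE_iff)
    next
      case False
      then have "V i = spins" using i m atMost_iff by blast
      then show ?thesis using x i by (auto simp: PiE_iff)
    qed
    then have "x \<in> PiE {1..} V"
      using x by (auto simp: PiE_iff)
    then show "x \<in> A" using V(3) by blast
  qed
qed

text \<open>Replacing the coordinates of a generic configuration up to site \<open>n\<close> by \<open>s\<close> keeps every
  almost sure property and moves the sum towards \<open>s * \<infinity>\<close>.\<close>

lemma spin_sum_unbounded_on_open:
  assumes A: "openin conf_top A" "A \<noteq> {}" and s: "s \<in> spins"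
    and a: "summable (\<lambda>i. (a (Suc i))\<^sup>2)"
    and drift: "filterlim (\<lambda>n. \<Sum>i=1..n. a i * (1 - s * tanh (b i))) at_top sequentially"
    and conv: "AE x in spin_prod b. \<exists>L. (\<lambda>n. \<Sum>i=1..n. a i * x i + c i) \<longlonglongrightarrow> L"
    and Q: "AE x in spin_prod b. x \<in> A \<longrightarrow> Q x"
  shows "\<exists>y L. filterlim (\<lambda>n. s * L n) at_top sequentially \<and>
    (\<forall>n::nat. Q (y n) \<and> (\<lambda>N. \<Sum>i=1..N. a i * y n i + c i) \<longlonglongrightarrow> L n)"
proof -
  interpret P: prob_space "spin_prod b" by (rule prob_space_spin_prod)
  obtain p m where p: "\<And>i. p i \<in> spins"
    and cyl: "\<And>x. x \<in> PiE {1..} (\<lambda>_. spins) \<Longrightarrow> (\<And>i. 1 \<le> i \<Longrightarrow> i \<le> m \<Longrightarrow> x i = p i) \<Longrightarrow> x \<in> A"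
    using openin_conf_top_cylinder[OF A] by metis
  have ss: "s * s = 1" using s by (auto simp: spins_def)
  \<comment> \<open>The cylinder's spins up to \<open>m\<close> keep the configuration in
    \<open>A\<close>; the value \<open>s\<close> beyond \<open>m\<close> pushes the sum.\<close>
  define q where "q i = (if i \<le> m then p i else s)" for i
  have q: "q i \<in> spins" for i using p s by (simp add: q_def)
  define ov where "ov n x = (\<lambda>i. if i \<in> {1..n} then q i else x i)" for n :: nat and x :: "nat \<Rightarrow> real"
  \<comment> \<open>The sum of a_i (1 - s x_i) is the gain in direction \<open>s\<close> from
    setting the spins to \<open>s\<close>; its mean is the assumed drift.\<close>
  have "AE x in spin_prod b. filterlim (\<lambda>n. \<Sum>i=1..n. - s * a i * x i + a i) at_top sequentially"
  proof (rule AE_spin_sum_at_top)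
    show "summable (\<lambda>i. (- s * a (Suc i))\<^sup>2)"
      using a ss by (simp add: power_mult_distrib power2_eq_square[of s])
    have "- s * a i * tanh (b i) + a i = a i * (1 - s * tanh (b i))" for i
      by (simp add: algebra_simps)
    then show "filterlim (\<lambda>n. \<Sum>i=1..n. - s * a i * tanh (b i) + a i) at_top sequentially"
      using drift by simp
  qed
  moreover have "AE x in spin_prod b. \<forall>n. ov n x \<in> A \<longrightarrow> Q (ov n x)"
    unfolding ov_def AE_all_countable using AE_spin_prod_override[where q = q, OF Q q] by blast
  ultimately have "AE x in spin_prod b. x \<in> space (spin_prod b) \<and>
      (\<exists>L. (\<lambda>n. \<Sum>i=1..n. a i * x i + c i) \<longlonglongrightarrow> L) \<and>
      filterlim (\<lambda>n. \<Sum>i=1..n. - s * a i * x i + a i) at_top sequentially \<and>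
      (\<forall>n. ov n x \<in> A \<longrightarrow> Q (ov n x))"
    using conv AE_space by eventually_elim simp
  \<comment> \<open>An almost sure property of a probability measure has a witness; this one generic
    \<open>x\<close> serves all \<open>n\<close>.\<close>
  from eventually_happens'[OF P.ae_filter_bot this] obtain x L where x: "x \<in> PiE {1..} (\<lambda>_. spins)"
    and L: "(\<lambda>n. \<Sum>i=1..n. a i * x i + c i) \<longlonglongrightarrow> L"
    and top: "filterlim (\<lambda>n. \<Sum>i=1..n. - s * a i * x i + a i) at_top sequentially"
    and Qx: "\<And>n. ov n x \<in> A \<Longrightarrow> Q (ov n x)"
    unfolding space_spin_prod by blast
  define y where "y n = ov (m + n) x" for n
  \<comment> \<open>Overwriting changes finitely many terms, so the series still converges and its
    limit moves by exactly \<open>D n\<close>.\<close>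
  define D where "D n = (\<Sum>i=1..m + n. a i * (q i - x i))" for n
  have "y n \<in> A" for n
  proof (rule cyl)
    show "y n \<in> PiE {1..} (\<lambda>_. spins)"
      using x q by (auto simp: y_def ov_def PiE_iff extensional_def)
  qed (simp add: y_def ov_def q_def)
  then have Qy: "Q (y n)" for n
    using Qx by (simp add: y_def)
  moreover have "(\<lambda>N. \<Sum>i=1..N. a i * y n i + c i) \<longlonglongrightarrow> L + D n" for n
  proof (rule Lim_transform_eventually)
    show "(\<lambda>N. (\<Sum>i=1..N. a i * x i + c i) + D n) \<longlonglongrightarrow> L + D n"
      by (intro tendsto_add L tendsto_const)
    have "(\<Sum>i=1..N. a i * x i + c i) + D n = (\<Sum>i=1..N. a i * y n i + c i)" if "m + n \<le> N" for N
    proof -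
      have "D n = (\<Sum>i\<in>{1..m + n}. a i * (y n i - x i))"
        unfolding D_def by (intro sum.cong) (auto simp: y_def ov_def)
      also have "\<dots> = (\<Sum>i\<in>{1..N}. a i * (y n i - x i))"
        using that by (intro sum.mono_neutral_left) (auto simp: y_def ov_def)
      finally show ?thesis
        by (simp add: sum.distrib[symmetric] algebra_simps)
    qed
    then show "\<forall>\<^sub>F N in sequentially. (\<Sum>i=1..N. a i * x i + c i) + D n = (\<Sum>i=1..N. a i * y n i + c i)"
      unfolding eventually_sequentially by blast
  qed
  moreover have "filterlim (\<lambda>n. s * (L + D n)) at_top sequentially"
  proof -
    \<comment> \<open>The sites up to \<open>m\<close> carry the pattern instead of
      \<open>s\<close>; their deviation does not depend on \<open>n\<close>.\<close>
    define E where "E = (\<Sum>i=1..m. s * a i * (p i - s))"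
    have "s * D n = E + (\<Sum>i=1..m + n. - s * a i * x i + a i)" for n
    proof -
      have "s * D n = (\<Sum>i=1..m + n. s * a i * (q i - s) + (- s * a i * x i + a i))"
        unfolding D_def sum_distrib_left
        using ss by (intro sum.cong) (auto simp: algebra_simps)
      also have "\<dots> = (\<Sum>i=1..m + n. s * a i * (q i - s)) + (\<Sum>i=1..m + n. - s * a i * x i + a i)"
        by (rule sum.distrib)
      also have "(\<Sum>i=1..m + n. s * a i * (q i - s)) = (\<Sum>i=1..m. s * a i * (q i - s))"
        by (rule sum.mono_neutral_right) (auto simp: q_def)
      also have "\<dots> = E"
        unfolding E_def by (intro sum.cong) (auto simp: q_def)
      finally show ?thesis .
    qed
    moreover have "filterlim (\<lambda>n. \<Sum>i=1..m + n. - s * a i * x i + a i) at_top sequentially"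
      using filterlim_compose[OF top filterlim_add_const_nat_at_top[of m]] by (simp add: add.commute)
    ultimately have "filterlim (\<lambda>n. s * D n) at_top sequentially"
      by (simp add: filterlim_tendsto_add_at_top[OF tendsto_const])
    then show ?thesis
      unfolding distrib_left by (rule filterlim_tendsto_add_at_top[OF tendsto_const])
  qed
  ultimately show ?thesis
    by (intro exI[of _ y] exI[of _ "\<lambda>n. L + D n"]) simp
qed

section \<open>Oscillation on open sets, essential bounds and continuity\<close>

definition spin_exp :: "(nat \<Rightarrow> real) \<Rightarrow> (nat \<Rightarrow> real) \<Rightarrow> (nat \<Rightarrow> real) \<Rightarrow> ennreal" where
  "spin_exp a c x = exp_ext (lim (\<lambda>n. ereal (\<Sum>i=1..n. a i * x i + c i)))"

text \<open>Bounded fields keep the means away from saturation: s tanh b_i = tanh (s b_i) \<le> tanh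
  Z < 1, so the terms dominate a fixed positive multiple of a_i.\<close>

lemma spin_sum_drift_at_top:
  assumes a: "\<And>i. 1 \<le> i \<Longrightarrow> 0 < a i" "\<not> summable (\<lambda>i. a (Suc i))"
    and b: "\<And>i. \<bar>b i\<bar> \<le> Z" and s: "s \<in> spins"
  shows "filterlim (\<lambda>n. \<Sum>i=1..n. a i * (1 - s * tanh (b i))) at_top sequentially"
proof (rule sum_at_top_of_not_summable)
  have "s * tanh (b i) \<le> tanh Z" for i
  proof -
    have "s * tanh (b i) = tanh (s * b i)"
      using s by (auto simp: spins_def)
    also have "\<dots> \<le> tanh Z"
      using s b[of i] by (auto simp: spins_def)
    finally show ?thesis .
  qed
  then have le: "a (Suc i) * (1 - tanh Z) \<le> a (Suc i) * (1 - s * tanh (b (Suc i)))" for i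
    using a(1)[of "Suc i"] by (intro mult_left_mono) auto
  have Z: "0 < 1 - tanh Z" using tanh_real_lt_1[of Z] by simp
  show "0 \<le> a (Suc i) * (1 - s * tanh (b (Suc i)))" for i
    by (rule order_trans[OF _ le]) (use a(1)[of "Suc i"] Z in simp)
  show "\<not> summable (\<lambda>i. a (Suc i) * (1 - s * tanh (b (Suc i))))"
  proof
    assume "summable (\<lambda>i. a (Suc i) * (1 - s * tanh (b (Suc i))))"
    then have "summable (\<lambda>i. a (Suc i) * (1 - tanh Z))"
    proof (rule summable_comparison_test'[where N = 0])
      fix i
      have "0 \<le> a (Suc i) * (1 - tanh Z)" using a(1)[of "Suc i"] Z by simp
      then show "norm (a (Suc i) * (1 - tanh Z)) \<le> a (Suc i) * (1 - s * tanh (b (Suc i)))"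
        using le[of i] by simp
    qed
    from summable_mult2[OF this, of "1 / (1 - tanh Z)"] show False
      using a(2) Z by simp
  qed
qed

text \<open>An almost sure bound on \<open>A\<close> holds at the overwritten configurations
  \<open>y n\<close>, where the value is exp (L n); with s = -1 these values tend to 0, with s = 1
  to \<infinity>.\<close>

lemma spin_exp_unbounded_on_open:
  assumes A: "openin conf_top A" "A \<noteq> {}"
    and a: "\<And>i. 1 \<le> i \<Longrightarrow> 0 < a i" "\<not> summable (\<lambda>i. a (Suc i))" "summable (\<lambda>i. (a (Suc i))\<^sup>2)"
    and b: "\<And>i. \<bar>b i\<bar> \<le> Z"
    and conv: "AE x in spin_prod b. \<exists>L. (\<lambda>n. \<Sum>i=1..n. a i * x i + c i) \<longlonglongrightarrow> L"
  shows "(AE x in spin_prod b. x \<in> A \<longrightarrow> z \<le> spin_exp a c x) \<Longrightarrow> z = 0"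
    and "(AE x in spin_prod b. x \<in> A \<longrightarrow> spin_exp a c x \<le> z) \<Longrightarrow> z = \<infinity>"
proof -
  assume Q: "AE x in spin_prod b. x \<in> A \<longrightarrow> z \<le> spin_exp a c x"
  have s: "- 1 \<in> spins" by (simp add: spins_def)
  obtain y L where L: "filterlim (\<lambda>n. - 1 * L n) at_top sequentially"
    and y: "\<And>n. z \<le> spin_exp a c (y n)" "\<And>n. (\<lambda>N. \<Sum>i=1..N. a i * y n i + c i) \<longlonglongrightarrow> L n"
    using spin_sum_unbounded_on_open[OF A s a(3) spin_sum_drift_at_top[OF a(1,2) b s] conv Q] by blast
  have z: "z \<le> ennreal (exp (L n))" for n
    using y exp_ext_lim(2)[OF y(2)] by (simp add: spin_exp_def)
  then obtain r where r: "z = ennreal r" "0 \<le> r"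
    using ennreal_cases[of z] by (metis ennreal_less_top not_le top.extremum_unique)
  show "z = 0"
  proof (rule ccontr)
    assume "z \<noteq> 0"
    then have r0: "0 < r" using r by (cases "r = 0") auto
    \<comment> \<open>The inequality 1 + t \<le> exp t turns 1/r \<le> - L n into 1/r < exp (- L n),
      against r \<le> exp (L n).\<close>
    have "eventually (\<lambda>n. 1 / r \<le> - 1 * L n) sequentially"
      using L by (simp add: filterlim_at_top)
    then obtain n where n: "1 / r \<le> - L n"
      by (auto simp: eventually_sequentially)
    have "r \<le> exp (L n)" using z[of n] r by simp
    then have "exp (- L n) \<le> 1 / r"
      using r0 by (simp add: exp_minus field_simps)
    then show False
      using exp_ge_add_one_self[of "- L n"] n by linarith
  qed
next
  assume Q: "AE x in spin_prod b. x \<in> A \<longrightarrow> spin_exp a c x \<le> z"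
  have s: "1 \<in> spins" by (simp add: spins_def)
  obtain y L where L: "filterlim (\<lambda>n. 1 * L n) at_top sequentially"
    and y: "\<And>n. spin_exp a c (y n) \<le> z" "\<And>n. (\<lambda>N. \<Sum>i=1..N. a i * y n i + c i) \<longlonglongrightarrow> L n"
    using spin_sum_unbounded_on_open[OF A s a(3) spin_sum_drift_at_top[OF a(1,2) b s] conv Q] by blast
  have z: "ennreal (exp (L n)) \<le> z" for n
    using y exp_ext_lim(2)[OF y(2)] by (simp add: spin_exp_def)
  show "z = \<infinity>"
  proof (cases z)
    case (real r)
    have "eventually (\<lambda>n. r \<le> 1 * L n) sequentially"
      using L by (simp add: filterlim_at_top)
    then obtain n where n: "r \<le> L n"
      by (auto simp: eventually_sequentially)
    have "exp (L n) \<le> r" using z[of n] real by simp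
    then show ?thesis
      using exp_ge_add_one_self[of "L n"] n by linarith
  qed simp
qed

lemma openin_conf_top_sets:
  assumes "openin conf_top A"
  shows "A \<in> sets (spin_prod b)"
  using assms unfolding sets_spin_prod sets_PiM_spins_eq_borel by blast

lemma essinf_esssup_of_unbounded:
  assumes h: "h \<in> borel_measurable (spin_prod b)" and A: "openin conf_top A"
    and inf: "\<And>z. (AE x in spin_prod b. x \<in> A \<longrightarrow> z \<le> h x) \<Longrightarrow> z = 0"
    and sup: "\<And>z. (AE x in spin_prod b. x \<in> A \<longrightarrow> h x \<le> z) \<Longrightarrow> z = \<infinity>"
  shows "essinf (restrict_space (spin_prod b) A) h = 0"
    and "esssup (restrict_space (spin_prod b) A) h = \<infinity>"
proof -
  have "A \<inter> space (spin_prod b) \<in> sets (spin_prod b)"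
    using openin_conf_top_sets[OF A] by blast
  note AE = AE_restrict_space_iff[OF this]
  have "z \<le> 0" if "AE x in restrict_space (spin_prod b) A. z \<le> h x" for z
    using inf[of z] that unfolding AE by simp
  then show "essinf (restrict_space (spin_prod b) A) h = 0"
    unfolding essinf_def by (intro antisym Sup_least) auto
  have "\<infinity> \<le> z" if "AE x in restrict_space (spin_prod b) A. h x \<le> z" for z
    using sup[of z] that unfolding AE by simp
  then have "\<infinity> \<le> Inf {z. AE x in restrict_space (spin_prod b) A. h x \<le> z}"
    by (intro Inf_greatest) simp
  then show "esssup (restrict_space (spin_prod b) A) h = \<infinity>"
    using esssup_eq_AE[OF measurable_restrict_space1[OF h]] by (simp add: top_unique)
qed

text \<open>A continuous \<open>g\<close> is above 1 near a point where it is infinite, and below a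
  finite \<open>w\<close> near any other point. Either way \<open>h\<close> would be essentially
  bounded on a smaller open set, which is why the two hypotheses range over all open
  \<open>U\<close>. Values in [0, \<infinity>] are allowed for \<open>g\<close>, so extensions
  taking the value \<infinity> are excluded too.\<close>

lemma no_continuous_version_of_unbounded:
  assumes inf: "\<And>U z. openin conf_top U \<Longrightarrow> U \<noteq> {} \<Longrightarrow> (AE x in M. x \<in> U \<longrightarrow> z \<le> h x) \<Longrightarrow> z = 0"
    and sup: "\<And>U z. openin conf_top U \<Longrightarrow> U \<noteq> {} \<Longrightarrow> (AE x in M. x \<in> U \<longrightarrow> h x \<le> z) \<Longrightarrow> z = \<infinity>"
    and A: "openin conf_top A" "A \<noteq> {}"
  shows "\<not> (\<exists>g. continuous_map (subtopology conf_top A) (euclidean :: ennreal topology) g \<and>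
    (AE x in M. x \<in> A \<longrightarrow> g x = h x))"
proof
  assume "\<exists>g. continuous_map (subtopology conf_top A) (euclidean :: ennreal topology) g \<and>
    (AE x in M. x \<in> A \<longrightarrow> g x = h x)"
  then obtain g where g: "continuous_map (subtopology conf_top A) (euclidean :: ennreal topology) g"
    and eq: "AE x in M. x \<in> A \<longrightarrow> g x = h x" by blast
  have top: "topspace (subtopology conf_top A) = A"
    using openin_subset[OF A(1)] by auto
  have op: "openin conf_top {x \<in> A. g x \<in> V}" if "open V" for V
  proof -
    have "openin (subtopology conf_top A) {x \<in> topspace (subtopology conf_top A). g x \<in> V}"
      by (rule openin_continuous_map_preimage[OF g]) (use that in simp)
    then show ?thesis
      unfolding top using openin_open_subtopology[OF A(1)] by blast
  qed
  obtain x0 where x0: "x0 \<in> A" using A by blast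
  show False
  proof (cases "g x0 = \<infinity>")
    case True
    let ?U = "{x \<in> A. g x \<in> {1<..}}"
    have "AE x in M. x \<in> ?U \<longrightarrow> 1 \<le> h x"
      using eq by eventually_elim auto
    moreover have "?U \<noteq> {}" using x0 True by auto
    ultimately show False
      using inf[OF op, of "{1<..}" 1] by simp
  next
    case False
    then obtain w where w: "g x0 < w" "w < \<infinity>"
      using dense[of "g x0" \<infinity>] by (auto simp: less_top)
    let ?U = "{x \<in> A. g x \<in> {..<w}}"
    have "AE x in M. x \<in> ?U \<longrightarrow> h x \<le> w"
      using eq by eventually_elim auto
    moreover have "?U \<noteq> {}" using x0 w by auto
    ultimately have "w = \<infinity>"
      using sup[OF op, of "{..<w}" w] by simp
    then show False using w by simp
  qed
qed

section \<open>Normalising constants and drifts for the given fields\<close>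

definition c_\<mu> :: "real \<Rightarrow> nat \<Rightarrow> real" where
  "c_\<mu> \<gamma> i = ln (cosh (zeta_part \<gamma> i) / cosh (zeta_sum \<gamma>))"

lemma h_\<rho>_eq_spin_exp: "h_\<rho> \<gamma> = spin_exp (\<alpha> \<gamma>) (\<lambda>_. 0)"
  by (simp add: fun_eq_iff h_\<rho>_def spin_exp_def S_\<rho>_def[abs_def])

lemma h_\<mu>_eq_spin_exp: "h_\<mu> \<gamma> = spin_exp (\<alpha> \<gamma>) (c_\<mu> \<gamma>)"
  by (simp add: fun_eq_iff h_\<mu>_def spin_exp_def S_\<mu>_def[abs_def] c_\<mu>_def)

lemma zeta_part_nonneg: "0 \<le> zeta_part \<gamma> i"
  unfolding zeta_part_def by (intro sum_nonneg) simp

lemma zeta_part_less: "1 < \<gamma> \<Longrightarrow> zeta_part \<gamma> i < zeta_sum \<gamma>"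
  using \<alpha>_pos[of \<gamma> i] by (simp add: \<alpha>_eq)

text \<open>\<open>c_\<mu>\<close> is minus the increment of ln cosh from the actual to the limiting
  field. The upper bound drives the exponent of h_\<mu> to -\<infinity> under \<rho>; the two bounds
  together make its mean converge under \<mu>.\<close>

lemma c_\<mu>_bounds:
  assumes "1 < \<gamma>"
  shows "c_\<mu> \<gamma> i \<le> - (tanh (zeta_part \<gamma> i) * \<alpha> \<gamma> i)"
    and "- (tanh (zeta_part \<gamma> i) * \<alpha> \<gamma> i) - (\<alpha> \<gamma> i)\<^sup>2 \<le> c_\<mu> \<gamma> i"
proof -
  have "c_\<mu> \<gamma> i = - ln (cosh (zeta_sum \<gamma>) / cosh (zeta_part \<gamma> i))"
    by (simp add: c_\<mu>_def ln_div)
  then show "c_\<mu> \<gamma> i \<le> - (tanh (zeta_part \<gamma> i) * \<alpha> \<gamma> i)"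
    and "- (tanh (zeta_part \<gamma> i) * \<alpha> \<gamma> i) - (\<alpha> \<gamma> i)\<^sup>2 \<le> c_\<mu> \<gamma> i"
    using ln_cosh_diff_bounds(1,2)[OF less_imp_le[OF zeta_part_less[OF assms, of i]]]
    by (simp_all add: \<alpha>_eq[OF assms])
qed

lemma tanh_zeta_part_ge: "1 \<le> i \<Longrightarrow> tanh 1 \<le> tanh (zeta_part \<gamma> i)"
  using zeta_part_ge_1[of i \<gamma>] by simp

text \<open>The first term of the zeta series is 1, so every mean is at least tanh 1 and the sum
  dominates tanh 1 times the divergent sum of the \<alpha>_i.\<close>

lemma drift_at_top:
  assumes "1 < \<gamma>" "\<gamma> \<le> 2"
  shows "filterlim (\<lambda>n. \<Sum>i=1..n. \<alpha> \<gamma> i * tanh (zeta_part \<gamma> i)) at_top sequentially"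
proof (rule sum_at_top_of_not_summable)
  have le: "tanh 1 * \<alpha> \<gamma> (Suc i) \<le> \<alpha> \<gamma> (Suc i) * tanh (zeta_part \<gamma> (Suc i))" for i
    using mult_right_mono[OF tanh_zeta_part_ge[of "Suc i" \<gamma>], of "\<alpha> \<gamma> (Suc i)"] \<alpha>_pos[OF assms(1), of "Suc i"]
    by (simp add: mult.commute)
  have pos: "0 \<le> tanh 1 * \<alpha> \<gamma> (Suc i)" for i
    using \<alpha>_pos[OF assms(1), of "Suc i"] by simp
  show "0 \<le> \<alpha> \<gamma> (Suc i) * tanh (zeta_part \<gamma> (Suc i))" for i
    using le[of i] pos[of i] by linarith
  show "\<not> summable (\<lambda>i. \<alpha> \<gamma> (Suc i) * tanh (zeta_part \<gamma> (Suc i)))"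
  proof
    assume "summable (\<lambda>i. \<alpha> \<gamma> (Suc i) * tanh (zeta_part \<gamma> (Suc i)))"
    then have "summable (\<lambda>i. tanh 1 * \<alpha> \<gamma> (Suc i))"
      by (rule summable_comparison_test'[where N = 0]) (use le pos in simp)
    then have "summable (\<lambda>i. \<alpha> \<gamma> (Suc i))"
      by (subst (asm) summable_cmult_iff) simp
    then show False using not_summable_\<alpha>[OF assms] by simp
  qed
qed

text \<open>The mean of \<alpha>_i x_i under \<mu> cancels the first-order part of
  \<open>c_\<mu>\<close>; the remainder is at most \<alpha>_i^2, which is summable.\<close>

lemma convergent_centred_drift:
  assumes "3 / 2 < \<gamma>"
  shows "convergent (\<lambda>n. \<Sum>i=1..n. \<alpha> \<gamma> i * tanh (zeta_part \<gamma> i) + c_\<mu> \<gamma> i)"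
proof -
  have \<gamma>: "1 < \<gamma>" using assms by simp
  have bound: "\<bar>\<alpha> \<gamma> i * tanh (zeta_part \<gamma> i) + c_\<mu> \<gamma> i\<bar> \<le> (\<alpha> \<gamma> i)\<^sup>2" for i
    using c_\<mu>_bounds[OF \<gamma>, of i] mult.commute[of "\<alpha> \<gamma> i" "tanh (zeta_part \<gamma> i)"]
      zero_le_power2[of "\<alpha> \<gamma> i"] unfolding abs_le_iff by linarith
  have "summable (\<lambda>i. (\<alpha> \<gamma> (Suc i))\<^sup>2)"
    using summable_\<alpha>_sq_iff[OF \<gamma>] assms by simp
  then have "summable (\<lambda>i. \<alpha> \<gamma> (Suc i) * tanh (zeta_part \<gamma> (Suc i)) + c_\<mu> \<gamma> (Suc i))"
    by (rule summable_comparison_test'[where N = 0]) (simp add: bound)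
  from summable_LIMSEQ[OF this] show ?thesis
    unfolding One_nat_def sum.atLeast1_atMost_eq by (rule convergentI)
qed

text \<open>The conjuncts with \<open>convergent\<close> certify that \<open>lim\<close> is a
  genuine limit there. Failure of local continuous extension is expressed almost everywhere on each
  nonempty open set, since h is determined only up to null sets.\<close>

theorem theorem6p1:
  fixes \<gamma> :: real
  assumes "1 < \<gamma>" and "\<gamma> \<le> 2"
  shows
    "(3/2 < \<gamma> \<longrightarrow>
        (AE x in \<rho>. convergent (S_\<rho> \<gamma> x) \<and> h_\<rho> \<gamma> x < \<infinity>) \<and>
        (AE x in \<mu> \<gamma>. convergent (S_\<mu> \<gamma> x) \<and> h_\<mu> \<gamma> x < \<infinity>))
   \<and> (3/2 < \<gamma> \<and> \<gamma> \<le> 2 \<longrightarrow>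
        (AE x in \<mu> \<gamma>. convergent (S_\<rho> \<gamma> x) \<and> h_\<rho> \<gamma> x = \<infinity>) \<and>
        (AE x in \<rho>. convergent (S_\<mu> \<gamma> x) \<and> h_\<mu> \<gamma> x = 0))
   \<and> (3/2 < \<gamma> \<longrightarrow>
        absolutely_continuous (\<mu> \<gamma>) (\<mu>_tilde \<gamma>) \<and>
        absolutely_continuous (\<mu>_tilde \<gamma>) (\<mu> \<gamma>) \<and>
        \<mu>_tilde \<gamma> = density (\<mu> \<gamma>) (h_\<mu> \<gamma>))
   \<and> (1 < \<gamma> \<and> \<gamma> \<le> 3/2 \<longrightarrow>
        mutually_singular (\<mu> \<gamma>) (\<mu>_tilde \<gamma>) \<and>
        mutually_singular (\<mu> \<gamma>) \<rho> \<and>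
        mutually_singular (\<mu>_tilde \<gamma>) \<rho>)
   \<and> (3/2 < \<gamma> \<and> \<gamma> \<le> 2 \<longrightarrow>
        (\<forall>A. openin conf_top A \<and> A \<noteq> {} \<longrightarrow>
           essinf (restrict_space \<rho> A) (h_\<rho> \<gamma>) = 0 \<and>
           essinf (restrict_space (\<mu> \<gamma>) A) (h_\<mu> \<gamma>) = 0 \<and>
           esssup (restrict_space \<rho> A) (h_\<rho> \<gamma>) = \<infinity> \<and>
           esssup (restrict_space (\<mu> \<gamma>) A) (h_\<mu> \<gamma>) = \<infinity> \<and>
           \<not> (\<exists>g. continuous_map (subtopology conf_top A) (euclidean :: ennreal topology) g \<and>
                  (AE x in \<rho>. x \<in> A \<longrightarrow> g x = h_\<rho> \<gamma> x)) \<and>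
           \<not> (\<exists>g. continuous_map (subtopology conf_top A) (euclidean :: ennreal topology) g \<and>
                  (AE x in \<mu> \<gamma>. x \<in> A \<longrightarrow> g x = h_\<mu> \<gamma> x))))"
proof -
  have zeta: "\<bar>zeta_part \<gamma> i\<bar> \<le> zeta_sum \<gamma>" for i
    using zeta_part_nonneg[of \<gamma> i] zeta_part_less[OF assms(1), of i] by simp
  have zeta_sum: "1 \<le> zeta_sum \<gamma>"
    using zeta_part_ge_1[of 1 \<gamma>] zeta_part_less[OF assms(1), of 1] by simp
  have S_\<rho>: "S_\<rho> \<gamma> x = (\<lambda>n. ereal (\<Sum>i=1..n. \<alpha> \<gamma> i * x i + 0))" for x
    by (simp add: S_\<rho>_def fun_eq_iff)
  have S_\<mu>: "S_\<mu> \<gamma> x = (\<lambda>n. ereal (\<Sum>i=1..n. \<alpha> \<gamma> i * x i + c_\<mu> \<gamma> i))" for x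
    by (simp add: S_\<mu>_def c_\<mu>_def fun_eq_iff)
  show ?thesis
  proof (cases "3 / 2 < \<gamma>")
    case True
    have sq: "summable (\<lambda>i. (\<alpha> \<gamma> (Suc i))\<^sup>2)"
      using summable_\<alpha>_sq_iff[OF assms(1)] True by simp
    have conv_\<rho>: "AE x in \<rho>. \<exists>L. (\<lambda>n. \<Sum>i=1..n. \<alpha> \<gamma> i * x i + 0) \<longlonglongrightarrow> L"
      unfolding \<rho>_eq_spin_prod
      by (rule AE_spin_sum_convergent[where c = "\<lambda>_. 0"]) (simp_all add: sq convergent_const)
    have conv_\<mu>: "AE x in \<mu> \<gamma>. \<exists>L. (\<lambda>n. \<Sum>i=1..n. \<alpha> \<gamma> i * x i + c_\<mu> \<gamma> i) \<longlonglongrightarrow> L"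
      unfolding \<mu>_eq_spin_prod
      by (rule AE_spin_sum_convergent[OF sq convergent_centred_drift[OF True]])
    have finite_\<rho>: "AE x in \<rho>. convergent (S_\<rho> \<gamma> x) \<and> h_\<rho> \<gamma> x < \<infinity>"
      using conv_\<rho>
    proof eventually_elim
      case (elim x)
      then obtain L where "(\<lambda>n. \<Sum>i=1..n. \<alpha> \<gamma> i * x i + 0) \<longlonglongrightarrow> L" by blast
      from exp_ext_lim[OF this] show ?case by (simp add: h_\<rho>_def S_\<rho>)
    qed
    have pos_\<mu>: "AE x in \<mu> \<gamma>. convergent (S_\<mu> \<gamma> x) \<and> 0 < h_\<mu> \<gamma> x \<and> h_\<mu> \<gamma> x < \<infinity>"
      using conv_\<mu>
    proof eventually_elim
      case (elim x)
      then obtain L where "(\<lambda>n. \<Sum>i=1..n. \<alpha> \<gamma> i * x i + c_\<mu> \<gamma> i) \<longlonglongrightarrow> L" by blast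
      from exp_ext_lim[OF this] show ?case by (simp add: h_\<mu>_def S_\<mu>)
    qed
    then have finite_\<mu>: "AE x in \<mu> \<gamma>. convergent (S_\<mu> \<gamma> x) \<and> h_\<mu> \<gamma> x < \<infinity>"
      by eventually_elim simp
    have infinite_\<mu>: "AE x in \<mu> \<gamma>. convergent (S_\<rho> \<gamma> x) \<and> h_\<rho> \<gamma> x = \<infinity>"
    proof -
      have "AE x in \<mu> \<gamma>. filterlim (\<lambda>n. \<Sum>i=1..n. \<alpha> \<gamma> i * x i + 0) at_top sequentially"
        unfolding \<mu>_eq_spin_prod
        by (rule AE_spin_sum_at_top[where c = "\<lambda>_. 0"]) (use sq drift_at_top[OF assms] in simp_all)
      then show ?thesis
      proof eventually_elim
        case (elim x)
        from exp_ext_lim_at_top[OF this] show ?case by (simp add: h_\<rho>_def S_\<rho>)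
      qed
    qed
    have zero_\<rho>: "AE x in \<rho>. convergent (S_\<mu> \<gamma> x) \<and> h_\<mu> \<gamma> x = 0"
    proof -
      \<comment> \<open>Under \<rho> the spins have mean 0, so the drift consists of the constants
        \<open>c_\<mu>\<close> alone, and these lie below minus the divergent drift under
        \<mu>.\<close>
      have "filterlim (\<lambda>n. - (\<Sum>i=1..n. \<alpha> \<gamma> i * tanh (zeta_part \<gamma> i))) at_bot sequentially"
        using drift_at_top[OF assms] by (simp add: filterlim_uminus_at_top)
      moreover have "(\<Sum>i=1..n. \<alpha> \<gamma> i * tanh 0 + c_\<mu> \<gamma> i) \<le> - (\<Sum>i=1..n. \<alpha> \<gamma> i * tanh (zeta_part \<gamma> i))" for n
        unfolding sum_negf[symmetric] using c_\<mu>_bounds(1)[OF assms(1)]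
        by (intro sum_mono) (simp add: mult.commute)
      ultimately have "filterlim (\<lambda>n. \<Sum>i=1..n. \<alpha> \<gamma> i * tanh 0 + c_\<mu> \<gamma> i) at_bot sequentially"
        by (auto intro: filterlim_at_bot_mono)
      then have "AE x in \<rho>. filterlim (\<lambda>n. \<Sum>i=1..n. \<alpha> \<gamma> i * x i + c_\<mu> \<gamma> i) at_bot sequentially"
        unfolding \<rho>_eq_spin_prod by (rule AE_spin_sum_at_bot[OF sq])
      then show ?thesis
      proof eventually_elim
        case (elim x)
        from exp_ext_lim_at_bot[OF this] show ?case by (simp add: h_\<mu>_def S_\<mu>)
      qed
    qed
    have h_meas: "h_\<rho> \<gamma> \<in> borel_measurable (spin_prod b)" "h_\<mu> \<gamma> \<in> borel_measurable (spin_prod b)" for b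
      by (rule borel_measurable_h[OF sets_spin_prod])+
    have dens: "\<mu>_tilde \<gamma> = density (\<mu> \<gamma>) (h_\<mu> \<gamma>)"
      unfolding \<mu>_eq_spin_prod \<mu>_tilde_eq_spin_prod
    proof (rule spin_prod_eq_density[OF h_meas(2)])
      \<comment> \<open>As \<alpha>_i is the field difference, the product of one-site densities is
        the exponential of the partial sum defining h_\<mu>.\<close>
      have prod: "(\<Prod>i=1..n. spin_ratio (zeta_part \<gamma> i) (zeta_sum \<gamma>) (x i)) =
          exp (\<Sum>i=1..n. \<alpha> \<gamma> i * x i + c_\<mu> \<gamma> i)" for n x
        unfolding exp_sum[OF finite_atLeastAtMost]
        by (intro prod.cong)
          (simp_all add: spin_ratio_def c_\<mu>_def exp_add \<alpha>_eq[OF assms(1)] mult.commute)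
      show "AE x in spin_prod (zeta_part \<gamma>).
          (\<lambda>n. ennreal (\<Prod>i=1..n. spin_ratio (zeta_part \<gamma> i) (zeta_sum \<gamma>) (x i))) \<longlonglongrightarrow> h_\<mu> \<gamma> x"
        using conv_\<mu> unfolding \<mu>_eq_spin_prod
      proof eventually_elim
        case (elim x)
        then obtain L where L: "(\<lambda>n. \<Sum>i=1..n. \<alpha> \<gamma> i * x i + c_\<mu> \<gamma> i) \<longlonglongrightarrow> L" by blast
        then have "(\<lambda>n. ennreal (exp (\<Sum>i=1..n. \<alpha> \<gamma> i * x i + c_\<mu> \<gamma> i))) \<longlonglongrightarrow> ennreal (exp L)"
          by (intro tendsto_ennrealI tendsto_exp)
        then show ?case
          unfolding prod using exp_ext_lim(2)[OF L] by (simp add: h_\<mu>_def S_\<mu>)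
      qed
      show "summable (\<lambda>i. (zeta_sum \<gamma> - zeta_part \<gamma> (Suc i))\<^sup>2)"
        using sq by (simp add: \<alpha>_eq[OF assms(1)])
    qed
    have ac: "absolutely_continuous (\<mu> \<gamma>) (\<mu>_tilde \<gamma>)"
      unfolding dens using h_meas(2) by (intro absolutely_continuousI_density) (simp add: \<mu>_eq_spin_prod)
    have ac': "absolutely_continuous (\<mu>_tilde \<gamma>) (\<mu> \<gamma>)"
      unfolding absolutely_continuous_def
    proof
      fix N assume "N \<in> null_sets (\<mu>_tilde \<gamma>)"
      then have N: "N \<in> sets (\<mu> \<gamma>)" "AE x in \<mu> \<gamma>. x \<in> N \<longrightarrow> h_\<mu> \<gamma> x = 0"
        using null_sets_density_iff[OF h_meas(2)[of "zeta_part \<gamma>", folded \<mu>_eq_spin_prod]]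
        unfolding dens by simp_all
      \<comment> \<open>h_\<mu> is almost surely the exponential of a finite limit, hence positive;
        it cannot vanish almost everywhere on a set of positive measure.\<close>
      from N(2) pos_\<mu>
      have "AE x in \<mu> \<gamma>. x \<notin> N"
        by eventually_elim auto
      then show "N \<in> null_sets (\<mu> \<gamma>)"
        using N(1) by (simp add: AE_iff_null_sets)
    qed
    have oscillation: "\<forall>A. openin conf_top A \<and> A \<noteq> {} \<longrightarrow>
           essinf (restrict_space \<rho> A) (h_\<rho> \<gamma>) = 0 \<and>
           essinf (restrict_space (\<mu> \<gamma>) A) (h_\<mu> \<gamma>) = 0 \<and>
           esssup (restrict_space \<rho> A) (h_\<rho> \<gamma>) = \<infinity> \<and>
           esssup (restrict_space (\<mu> \<gamma>) A) (h_\<mu> \<gamma>) = \<infinity> \<and>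
           \<not> (\<exists>g. continuous_map (subtopology conf_top A) (euclidean :: ennreal topology) g \<and>
                  (AE x in \<rho>. x \<in> A \<longrightarrow> g x = h_\<rho> \<gamma> x)) \<and>
           \<not> (\<exists>g. continuous_map (subtopology conf_top A) (euclidean :: ennreal topology) g \<and>
                  (AE x in \<mu> \<gamma>. x \<in> A \<longrightarrow> g x = h_\<mu> \<gamma> x))"
    proof (rule allI, rule impI, elim conjE)
      fix A assume A: "openin conf_top A" "A \<noteq> {}"
      have inf_\<rho>: "z = 0" if "openin conf_top U" "U \<noteq> {}"
        "AE x in spin_prod (\<lambda>_. 0). x \<in> U \<longrightarrow> z \<le> h_\<rho> \<gamma> x" for U z
        using spin_exp_unbounded_on_open(1)[OF that(1,2) \<alpha>_pos[OF assms(1)] not_summable_\<alpha>[OF assms] sq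
            _ conv_\<rho>[unfolded \<rho>_eq_spin_prod], of 0 z] that(3) by (simp add: h_\<rho>_eq_spin_exp)
      have sup_\<rho>: "z = \<infinity>" if "openin conf_top U" "U \<noteq> {}"
        "AE x in spin_prod (\<lambda>_. 0). x \<in> U \<longrightarrow> h_\<rho> \<gamma> x \<le> z" for U z
        using spin_exp_unbounded_on_open(2)[OF that(1,2) \<alpha>_pos[OF assms(1)] not_summable_\<alpha>[OF assms] sq
            _ conv_\<rho>[unfolded \<rho>_eq_spin_prod], of 0 z] that(3) by (simp add: h_\<rho>_eq_spin_exp)
      have inf_\<mu>: "z = 0" if "openin conf_top U" "U \<noteq> {}"
        "AE x in spin_prod (zeta_part \<gamma>). x \<in> U \<longrightarrow> z \<le> h_\<mu> \<gamma> x" for U z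
        using spin_exp_unbounded_on_open(1)[OF that(1,2) \<alpha>_pos[OF assms(1)] not_summable_\<alpha>[OF assms] sq
            zeta conv_\<mu>[unfolded \<mu>_eq_spin_prod], of z] that(3) by (simp add: h_\<mu>_eq_spin_exp)
      have sup_\<mu>: "z = \<infinity>" if "openin conf_top U" "U \<noteq> {}"
        "AE x in spin_prod (zeta_part \<gamma>). x \<in> U \<longrightarrow> h_\<mu> \<gamma> x \<le> z" for U z
        using spin_exp_unbounded_on_open(2)[OF that(1,2) \<alpha>_pos[OF assms(1)] not_summable_\<alpha>[OF assms] sq
            zeta conv_\<mu>[unfolded \<mu>_eq_spin_prod], of z] that(3) by (simp add: h_\<mu>_eq_spin_exp)
      note ess_\<rho> = essinf_esssup_of_unbounded[OF h_meas(1) A(1) inf_\<rho>[OF A] sup_\<rho>[OF A]]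
      note ess_\<mu> = essinf_esssup_of_unbounded[OF h_meas(2) A(1) inf_\<mu>[OF A] sup_\<mu>[OF A]]
      note cont_\<rho> = no_continuous_version_of_unbounded[OF inf_\<rho> sup_\<rho> A]
      note cont_\<mu> = no_continuous_version_of_unbounded[OF inf_\<mu> sup_\<mu> A]
      show "essinf (restrict_space \<rho> A) (h_\<rho> \<gamma>) = 0 \<and>
           essinf (restrict_space (\<mu> \<gamma>) A) (h_\<mu> \<gamma>) = 0 \<and>
           esssup (restrict_space \<rho> A) (h_\<rho> \<gamma>) = \<infinity> \<and>
           esssup (restrict_space (\<mu> \<gamma>) A) (h_\<mu> \<gamma>) = \<infinity> \<and>
           \<not> (\<exists>g. continuous_map (subtopology conf_top A) (euclidean :: ennreal topology) g \<and>
                  (AE x in \<rho>. x \<in> A \<longrightarrow> g x = h_\<rho> \<gamma> x)) \<and>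
           \<not> (\<exists>g. continuous_map (subtopology conf_top A) (euclidean :: ennreal topology) g \<and>
                  (AE x in \<mu> \<gamma>. x \<in> A \<longrightarrow> g x = h_\<mu> \<gamma> x))"
        unfolding \<rho>_eq_spin_prod \<mu>_eq_spin_prod by (intro conjI ess_\<rho> ess_\<mu> cont_\<rho> cont_\<mu>)
    qed
    show ?thesis
      by (intro conjI impI; (rule finite_\<rho> finite_\<mu> infinite_\<mu> zero_\<rho> ac ac' dens oscillation | use True in simp))
  next
    case False
    have "mutually_singular (\<mu> \<gamma>) (\<mu>_tilde \<gamma>)"
      unfolding \<mu>_eq_spin_prod \<mu>_tilde_eq_spin_prod
    proof (rule spin_prod_mutually_singular[where Z = "zeta_sum \<gamma>"])
      show "\<not> summable (\<lambda>i. (zeta_sum \<gamma> - zeta_part \<gamma> (Suc i))\<^sup>2)"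
        using summable_\<alpha>_sq_iff[OF assms(1)] False by (simp add: \<alpha>_eq[OF assms(1)])
    qed (use zeta zeta_sum in auto)
    moreover have "mutually_singular (\<mu> \<gamma>) \<rho>"
      unfolding \<mu>_eq_spin_prod \<rho>_eq_spin_prod
    proof (rule spin_prod_mutually_singular[where Z = "zeta_sum \<gamma>"])
      \<comment> \<open>Fields of at least 1 against field 0: the squared differences stay away from
        0.\<close>
      show "\<not> summable (\<lambda>i. (0 - zeta_part \<gamma> (Suc i))\<^sup>2)"
      proof
        assume "summable (\<lambda>i. (0 - zeta_part \<gamma> (Suc i))\<^sup>2)"
        then have "summable (\<lambda>_::nat. 1 :: real)"
          by (rule summable_comparison_test'[where N = 0])
            (use zeta_part_ge_1[of "Suc _" \<gamma>] in \<open>auto simp: one_le_power\<close>)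
        then show False using summable_const_iff[of "1 :: real"] by simp
      qed
    qed (use zeta zeta_sum in auto)
    moreover have "mutually_singular (\<mu>_tilde \<gamma>) \<rho>"
      unfolding \<mu>_tilde_eq_spin_prod \<rho>_eq_spin_prod
      using zeta_sum summable_const_iff[of "(0 - zeta_sum \<gamma>)\<^sup>2"]
      by (intro spin_prod_mutually_singular[where Z = "zeta_sum \<gamma>"]) simp_all
    ultimately show ?thesis
      using False by simp
  qed
qed

end
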